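(* The Anonymous Refugees Housing problem is fixed-parameter tractable when parameterized by the combined parameter $|R|+|I|$, i.e. the number of refugees plus the number of inhabitants.
   Context: An instance of Anonymous Refugees Housing (ARH) consists of: a finite simple undirected graph $G=(V,E)$ (the topology); a finite non-empty set $R$ of refugees and a finite set $I$ of inhabitants with $|V|\ge |R|+|I|$; an injective map $\iota\colon I\to V$; and for each $h\in I$ a non-empty approval set $A_h\subseteq\{0,1,\ldots,\deg(\iota(h))\}$. Let $V_I=\iota(I)$ and $V_U=V\setminus V_I$. A housing is an injective map $\pi\colon R\to V_U$, and $V_\pi=\pi(R)$. A housing $\pi$ is inhabitant-respecting if $|N_G(\iota(h))\cap V_\pi|\in A_h$ for every $h\in I$. The question is whether an inhabitant-respecting housing exists. A parameterized problem is fixed-parameter tractable if it is solvable in $f(k)\cdot n^{\mathcal{O}(1)}$ time for some computable $f$, where $k$ is the parameter and $n$ the input size. *)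

theory Defs
  imports Main
begin

section \<open>Model of computation\<close>

text \<open>
  The machine model is the language WHILE of N. D. Jones (Computability and Complexity from a
  Programming Perspective, 1997), with his running-time measure: programs with finitely many
  variables holding binary trees, where each elementary operation costs one unit.  Trees can only be
  built, taken apart and tested for being the atom; whole trees are never compared,
  so that with a shared pointer representation every operation takes constant time.  Up to a
  polynomial factor, running times therefore agree with those of Turing machines (and of random
  access machines).
\<close>

datatype data = Atom | Pair data data

primrec nodes :: "data \<Rightarrow> nat" where
  "nodes Atom = 1"
| "nodes (Pair a b) = 1 + nodes a + nodes b"

fun fst_data :: "data \<Rightarrow> data" where
  "fst_data Atom = Atom"
| "fst_data (Pair a b) = a"

fun snd_data :: "data \<Rightarrow> data" where
  "snd_data Atom = Atom"
| "snd_data (Pair a b) = b"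

type_synonym vname = nat

type_synonym state = "vname \<Rightarrow> data"

datatype exp = Var vname | AtomE | PairE exp exp | FstE exp | SndE exp

primrec val :: "exp \<Rightarrow> state \<Rightarrow> data" where
  "val (Var x) s = s x"
| "val AtomE s = Atom"
| "val (PairE e1 e2) s = Pair (val e1 s) (val e2 s)"
| "val (FstE e) s = fst_data (val e s)"
| "val (SndE e) s = snd_data (val e s)"

primrec cost :: "exp \<Rightarrow> nat" where
  "cost (Var x) = 1"
| "cost AtomE = 1"
| "cost (PairE e1 e2) = 1 + cost e1 + cost e2"
| "cost (FstE e) = 1 + cost e"
| "cost (SndE e) = 1 + cost e"

datatype com = Skip | Assign vname exp | Seq com com | If exp com com | While exp com

text \<open>
  \<open>exec p s t s'\<close>: started in \<open>s\<close>, program \<open>p\<close> halts in \<open>s'\<close> after exactly \<open>t\<close> time units.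
  \<open>Atom\<close> plays the role of \<open>False\<close>, every other tree that of \<open>True\<close>.
\<close>

inductive exec :: "com \<Rightarrow> state \<Rightarrow> nat \<Rightarrow> state \<Rightarrow> bool" where
  Skip: "exec Skip s 1 s"
| Assign: "exec (Assign x e) s (1 + cost e) (s(x := val e s))"
| Seq: "exec p s t s' \<Longrightarrow> exec q s' t' s'' \<Longrightarrow> exec (Seq p q) s (t + t') s''"
| IfTrue: "val e s \<noteq> Atom \<Longrightarrow> exec p s t s' \<Longrightarrow> exec (If e p q) s (1 + cost e + t) s'"
| IfFalse: "val e s = Atom \<Longrightarrow> exec q s t s' \<Longrightarrow> exec (If e p q) s (1 + cost e + t) s'"
| WhileFalse: "val e s = Atom \<Longrightarrow> exec (While e p) s (1 + cost e) s"
| WhileTrue: "val e s \<noteq> Atom \<Longrightarrow> exec p s t s' \<Longrightarrow> exec (While e p) s' t' s'' \<Longrightarrow>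
    exec (While e p) s (1 + cost e + t + t') s''"

inductive_cases SkipE: "exec Skip s t s'"
inductive_cases AssignE: "exec (Assign x e) s t s'"
inductive_cases SeqE: "exec (Seq p q) s t s'"
inductive_cases IfE: "exec (If e p q) s t s'"
inductive_cases WhileE: "exec (While e p) s t s'"

lemma exec_deterministic:
  "exec p s t s' \<Longrightarrow> exec p s u s'' \<Longrightarrow> u = t \<and> s'' = s'"
proof (induction arbitrary: u s'' rule: exec.induct)
  case Skip
  then show ?case by (auto elim: SkipE)
next
  case Assign
  then show ?case by (auto elim: AssignE)
next
  case Seq
  from Seq.prems show ?case by (rule SeqE) (use Seq.IH in metis)
next
  case IfTrue
  from IfTrue.prems show ?case by (rule IfE) (use IfTrue.hyps in \<open>auto dest!: IfTrue.IH\<close>)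
next
  case IfFalse
  from IfFalse.prems show ?case by (rule IfE) (use IfFalse.hyps in \<open>auto dest!: IfFalse.IH\<close>)
next
  case WhileFalse
  from WhileFalse.prems show ?case by (rule WhileE) (use WhileFalse.hyps in auto)
next
  case WhileTrue
  from WhileTrue.prems show ?case by (rule WhileE) (use WhileTrue.hyps in \<open>auto dest!: WhileTrue.IH\<close>)
qed

text \<open>Variable 0 holds the input at the start and the output at the end.\<close>

definition outputs :: "com \<Rightarrow> data \<Rightarrow> nat \<Rightarrow> data \<Rightarrow> bool" where
  "outputs p d t r \<longleftrightarrow> (\<exists>s. exec p ((\<lambda>_. Atom)(0 := d)) t s \<and> s 0 = r)"

primrec num :: "nat \<Rightarrow> data" where
  "num 0 = Atom"
| "num (Suc n) = Pair Atom (num n)"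

primrec list_data :: "data list \<Rightarrow> data" where
  "list_data [] = Atom"
| "list_data (x # xs) = Pair x (list_data xs)"

definition bit :: "bool \<Rightarrow> data" where
  "bit b = (if b then Pair Atom Atom else Atom)"

definition computable :: "(nat \<Rightarrow> nat) \<Rightarrow> bool" where
  "computable f \<longleftrightarrow> (\<exists>p. \<forall>k. \<exists>t. outputs p (num k) t (num (f k)))"


section \<open>Fixed-parameter tractability\<close>

text \<open>
  A parameterized problem is given by its set of instances, the yes-instances among them, the
  parameter, and the relation telling which input data represent an instance.  As an instance
  may list its vertices etc. in any order, it may have several representations;
  the algorithm has to work on each of them.
\<close>

definition fixed_parameter_tractable ::
  "'i set \<Rightarrow> ('i \<Rightarrow> bool) \<Rightarrow> ('i \<Rightarrow> nat) \<Rightarrow> ('i \<Rightarrow> data \<Rightarrow> bool) \<Rightarrow> bool" where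
  "fixed_parameter_tractable instances yes param represented_by \<longleftrightarrow>
    (\<exists>p f c. computable f \<and>
      (\<forall>J \<in> instances. \<forall>d. represented_by J d \<longrightarrow>
        (\<exists>t r. outputs p d t r \<and>
               t \<le> f (param J) * nodes d ^ c \<and>
               (r \<noteq> Atom \<longleftrightarrow> yes J))))"


section \<open>Anonymous Refugees Housing\<close>

record ('v, 'r, 'h) arh =
  verts :: "'v set"
  edges :: "'v set set"
  refugees :: "'r set"
  inhabitants :: "'h set"
  home :: "'h \<Rightarrow> 'v"
  approval :: "'h \<Rightarrow> nat set"

definition simple_graph :: "'v set \<Rightarrow> 'v set set \<Rightarrow> bool" where
  "simple_graph V E \<longleftrightarrow> finite V \<and> (\<forall>e \<in> E. e \<subseteq> V \<and> card e = 2)"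

definition nbhd :: "('v, 'r, 'h) arh \<Rightarrow> 'v \<Rightarrow> 'v set" where
  "nbhd J v = {u. {v, u} \<in> edges J}"

definition degree :: "('v, 'r, 'h) arh \<Rightarrow> 'v \<Rightarrow> nat" where
  "degree J v = card (nbhd J v)"

definition arh_instance :: "('v, 'r, 'h) arh \<Rightarrow> bool" where
  "arh_instance J \<longleftrightarrow>
     simple_graph (verts J) (edges J) \<and>
     finite (refugees J) \<and> refugees J \<noteq> {} \<and>
     finite (inhabitants J) \<and>
     card (verts J) \<ge> card (refugees J) + card (inhabitants J) \<and>
     home J ` inhabitants J \<subseteq> verts J \<and> inj_on (home J) (inhabitants J) \<and>
     (\<forall>h \<in> inhabitants J. approval J h \<noteq> {} \<and> approval J h \<subseteq> {0..degree J (home J h)})"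

definition occupied :: "('v, 'r, 'h) arh \<Rightarrow> 'v set" where
  "occupied J = home J ` inhabitants J"

definition unoccupied :: "('v, 'r, 'h) arh \<Rightarrow> 'v set" where
  "unoccupied J = verts J - occupied J"

definition housing :: "('v, 'r, 'h) arh \<Rightarrow> ('r \<Rightarrow> 'v) \<Rightarrow> bool" where
  "housing J \<pi> \<longleftrightarrow> \<pi> ` refugees J \<subseteq> unoccupied J \<and> inj_on \<pi> (refugees J)"

definition inhabitant_respecting :: "('v, 'r, 'h) arh \<Rightarrow> ('r \<Rightarrow> 'v) \<Rightarrow> bool" where
  "inhabitant_respecting J \<pi> \<longleftrightarrow>
     (\<forall>h \<in> inhabitants J. card (nbhd J (home J h) \<inter> \<pi> ` refugees J) \<in> approval J h)"

definition arh_yes :: "('v, 'r, 'h) arh \<Rightarrow> bool" where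
  "arh_yes J \<longleftrightarrow> (\<exists>\<pi>. housing J \<pi> \<and> inhabitant_respecting J \<pi>)"

text \<open>
  For enumerations \<open>vs\<close> of the vertices and \<open>hs\<close> of the inhabitants, an instance is written down as
  the number of refugees, the adjacency matrix, and for each inhabitant the position
  of its home together with the increasing list of its approved numbers.  All numbers involved are
  at most the number of vertices, so writing them in unary changes the input size only polynomially.
\<close>

definition position :: "'a list \<Rightarrow> 'a \<Rightarrow> nat" where
  "position xs x = length (takeWhile (\<lambda>y. y \<noteq> x) xs)"

definition arh_code :: "('v, 'r, 'h) arh \<Rightarrow> 'v list \<Rightarrow> 'h list \<Rightarrow> data" where
  "arh_code J vs hs = list_data
     [num (card (refugees J)),
      list_data (map (\<lambda>u. list_data (map (\<lambda>v. bit ({u, v} \<in> edges J)) vs)) vs),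
      list_data (map (\<lambda>h. Pair (num (position vs (home J h)))
                               (list_data (map num (sorted_list_of_set (approval J h))))) hs)]"

definition arh_represented_by :: "('v, 'r, 'h) arh \<Rightarrow> data \<Rightarrow> bool" where
  "arh_represented_by J d \<longleftrightarrow>
     (\<exists>vs hs. distinct vs \<and> set vs = verts J \<and>
              distinct hs \<and> set hs = inhabitants J \<and>
              d = arh_code J vs hs)"

lemma arh_representation_exists:
  "arh_instance J \<Longrightarrow> \<exists>d. arh_represented_by J d"
  unfolding arh_represented_by_def arh_instance_def simple_graph_def
  by (metis finite_distinct_list)

end

(* Dynamic programming in the style of subset sum.  Let r be the number of refugees and h_0, ...,
   h_(m-1) the inhabitants.  An unoccupied vertex u gets the weight B^m + sum of B^j over the j with
   h_j adjacent to u, where B = r + 1.  A set S of r such vertices has total weight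
   r B^m + sum_j |S \<inter> N(h_j)| B^j, and its base-B digits are the numbers to be compared with the
   approval sets.  All weights of vertex sets are at most n (m + 1) B^m, so a bit table indexed by them has
   size f(k) poly(n), and choosing a vertex amounts to shifting the table.  Afterwards one shifts back
   by all approved digits; a suitable S exists iff the bit at r B^m is then set.

   The WHILE programs are not written down: one shows that the functions computed by a program within
   polynomial time in a given resource bound are closed under composition, case distinction and
   iteration over lists. *)

theory Submission
  imports Defs
begin

section \<open>Evaluation by WHILE programs\<close>

text \<open>The base r + 1 is the smallest in which every count |S \<inter> N(h)| with |S| = r is a
  single digit, and the summand B^m makes |S| itself the leading digit, so one table position fixes
  the number of refugees and all counts together. The obstacle is that the time bound concerns an
  actual program, and WHILE has neither arithmetic nor random access. Numbers are therefore lists of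
  atoms and tables are lists of bits: addition and shifting prepend, subtraction and lookup take
  tails. This is affordable as long as all numbers stay polynomial in one resource bound K. In the
  end K is F(k) times the input size, where F(k) = (k + 2)^(k + 2) pays for B^m. Loops need one
  program and one time bound for all rounds; hence evaluation is stated for families over an index
  set, and a round is indexed by the input together with the loop counter.\<close>

definition poly_bounded :: "'a set \<Rightarrow> ('a \<Rightarrow> nat) \<Rightarrow> ('a \<Rightarrow> nat) \<Rightarrow> bool" where
  "poly_bounded X K f \<longleftrightarrow> (\<exists>c. \<forall>a \<in> X. f a \<le> (K a + 2) ^ c)"

lemma poly_bounded_mono:
  "poly_bounded X K f \<Longrightarrow> (\<And>a. a \<in> X \<Longrightarrow> g a \<le> f a) \<Longrightarrow> poly_bounded X K g"
  unfolding poly_bounded_def by (meson order_trans)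

text \<open>Here the summand 2 in the base pays off: even where \<open>K a\<close> is 0, the base is
  at least 2 and its n-th power exceeds n.\<close>

lemma poly_bounded_const: "poly_bounded X K (\<lambda>_. n)"
proof -
  have "n \<le> (K a + 2) ^ n" for a
    using power_mono[of 2 "K a + 2" n] less_exp[of n] by simp
  then show ?thesis unfolding poly_bounded_def by blast
qed

lemma poly_bounded_self: "poly_bounded X K K"
  unfolding poly_bounded_def by (rule exI[of _ 1]) auto

lemma poly_bounded_mult:
  assumes "poly_bounded X K f" "poly_bounded X K g"
  shows "poly_bounded X K (\<lambda>a. f a * g a)"
proof -
  from assms obtain c d where "\<forall>a\<in>X. f a \<le> (K a + 2) ^ c" "\<forall>a\<in>X. g a \<le> (K a + 2) ^ d"
    unfolding poly_bounded_def by blast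
  then have "\<forall>a\<in>X. f a * g a \<le> (K a + 2) ^ (c + d)"
    by (simp add: power_add mult_mono)
  then show ?thesis unfolding poly_bounded_def by blast
qed

text \<open>Reduced to products by f + g \<le> (f + 1) * (g + 1); the added 1 costs one more
  exponent because the base is at least 2.\<close>

lemma poly_bounded_add:
  assumes "poly_bounded X K f" "poly_bounded X K g"
  shows "poly_bounded X K (\<lambda>a. f a + g a)"
proof -
  have "poly_bounded X K (\<lambda>a. (f a + 1) * (g a + 1))"
    if *: "poly_bounded X K (\<lambda>a. f a + 1)" "poly_bounded X K (\<lambda>a. g a + 1)"
    using * by (rule poly_bounded_mult)
  moreover have "poly_bounded X K (\<lambda>a. f a + 1)" if f: "poly_bounded X K f" for f :: "'a \<Rightarrow> nat"
  proof -
    from f obtain c where "\<forall>a\<in>X. f a \<le> (K a + 2) ^ c"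
      unfolding poly_bounded_def by blast
    moreover have "(K a + 2) ^ c + 1 \<le> (K a + 2) ^ (c + 1)" for a
    proof -
      have "(K a + 2) ^ c + 1 \<le> 2 * (K a + 2) ^ c" using one_le_power[of "K a + 2" c] by simp
      also have "\<dots> \<le> (K a + 2) ^ (c + 1)" by simp
      finally show ?thesis .
    qed
    ultimately have "\<forall>a\<in>X. f a + 1 \<le> (K a + 2) ^ (c + 1)"
      by (meson add_le_mono1 order_trans)
    then show ?thesis unfolding poly_bounded_def by blast
  qed
  ultimately have "poly_bounded X K (\<lambda>a. (f a + 1) * (g a + 1))"
    using assms by blast
  then show ?thesis by (rule poly_bounded_mono) simp
qed

lemma poly_bounded_fst: "poly_bounded X K f \<Longrightarrow> poly_bounded (Sigma X B) (\<lambda>q. K (fst q)) (\<lambda>q. f (fst q))"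
  unfolding poly_bounded_def by auto

lemmas poly_bounded_intros =
  poly_bounded_const poly_bounded_self poly_bounded_mult poly_bounded_add poly_bounded_fst

text \<open>A bound that involves only \<open>K a\<close> serves all i at once; this yields one time
  bound for all rounds of a loop.\<close>

lemma poly_bounded_Max:
  assumes "poly_bounded (Sigma X B) (\<lambda>q. K (fst q)) T" and "\<And>a. a \<in> X \<Longrightarrow> finite (B a)"
  obtains U where "poly_bounded X K U" "\<And>a i. a \<in> X \<Longrightarrow> i \<in> B a \<Longrightarrow> T (a, i) \<le> U a"
proof -
  from assms obtain c where c: "\<forall>q\<in>Sigma X B. T q \<le> (K (fst q) + 2) ^ c"
    unfolding poly_bounded_def by blast
  show thesis
  proof (rule that[of "\<lambda>a. (K a + 2) ^ c"])
    show "poly_bounded X K (\<lambda>a. (K a + 2) ^ c)" unfolding poly_bounded_def by blast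
  qed (use c in auto)
qed

text \<open>The parameter \<open>K\<close> measures the resources available for \<open>a\<close>; times only matter up to a
  polynomial in \<open>K a\<close>.  Variables from some \<open>N\<close> on are left alone, so they can hold intermediate
  results of a surrounding program.\<close>

definition evaluates ::
  "'a set \<Rightarrow> ('a \<Rightarrow> nat) \<Rightarrow> ('a \<Rightarrow> data) \<Rightarrow> ('a \<Rightarrow> data) \<Rightarrow> bool" where
  "evaluates X K e g \<longleftrightarrow> (\<exists>p N T. poly_bounded X K T \<and> (\<forall>a \<in> X. \<forall>s. s 0 = e a \<longrightarrow>
     (\<exists>t s'. exec p s t s' \<and> t \<le> T a \<and> s' 0 = g a \<and> (\<forall>x \<ge> N. s' x = s x))))"

lemma evaluatesI:
  assumes "poly_bounded X K T"
    and "\<And>a s. a \<in> X \<Longrightarrow> s 0 = e a \<Longrightarrow>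
      \<exists>t s'. exec p s t s' \<and> t \<le> T a \<and> s' 0 = g a \<and> (\<forall>x \<ge> N. s' x = s x)"
  shows "evaluates X K e g"
  unfolding evaluates_def using assms by blast

text \<open>Raising N only weakens the claim about untouched variables, so N > 0 comes for free.
  Variable N is then safe scratch space: different from 0 and preserved by the program.\<close>

lemma evaluatesE:
  assumes "evaluates X K e g"
  obtains p N T where "poly_bounded X K T" "N > 0"
    "\<And>a s. a \<in> X \<Longrightarrow> s 0 = e a \<Longrightarrow>
      \<exists>t s'. exec p s t s' \<and> t \<le> T a \<and> s' 0 = g a \<and> (\<forall>x \<ge> N. s' x = s x)"
proof -
  from assms obtain p N T where *: "poly_bounded X K T" "\<forall>a \<in> X. \<forall>s. s 0 = e a \<longrightarrow>
     (\<exists>t s'. exec p s t s' \<and> t \<le> T a \<and> s' 0 = g a \<and> (\<forall>x \<ge> N. s' x = s x))"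
    unfolding evaluates_def by blast
  show thesis
    by (rule that[of T "Suc N" p]) (use * Suc_leD in blast)+
qed

lemma evaluates_cong:
  assumes "evaluates X K e g" "\<And>a. a \<in> X \<Longrightarrow> e a = e' a" "\<And>a. a \<in> X \<Longrightarrow> g a = g' a"
  shows "evaluates X K e' g'"
  using assms(1) by (rule evaluatesE) (rule evaluatesI, assumption, simp add: assms(2,3)[symmetric])

lemma evaluates_fst_index:
  assumes "evaluates X K e g"
  shows "evaluates (Sigma X B) (\<lambda>q. K (fst q)) (\<lambda>q. e (fst q)) (\<lambda>q. g (fst q))"
  using assms
proof (rule evaluatesE)
  fix p N T
  assume "poly_bounded X K T"
    and *: "\<And>a s. a \<in> X \<Longrightarrow> s 0 = e a \<Longrightarrow>
      \<exists>t s'. exec p s t s' \<and> t \<le> T a \<and> s' 0 = g a \<and> (\<forall>x \<ge> N. s' x = s x)"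
  show ?thesis
    by (rule evaluatesI[OF poly_bounded_fst[OF \<open>poly_bounded X K T\<close>], where p = p and N = N])
      (rule *, auto)
qed

lemma evaluates_exp:
  assumes "\<And>a s. a \<in> X \<Longrightarrow> s 0 = e a \<Longrightarrow> val ex s = g a"
  shows "evaluates X K e g"
proof (rule evaluatesI)
  show "poly_bounded X K (\<lambda>_. 1 + cost ex)" by (rule poly_bounded_const)
  fix a and s :: state
  assume "a \<in> X" "s 0 = e a"
  with assms have "val ex s = g a" by blast
  then show "\<exists>t s'. exec (Assign 0 ex) s t s' \<and> t \<le> 1 + cost ex \<and> s' 0 = g a \<and>
      (\<forall>x \<ge> 1. s' x = s x)"
    using exec.Assign[of 0 ex s] by fastforce
qed

lemma evaluates_trans:
  assumes "evaluates X K e g" "evaluates X K g h"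
  shows "evaluates X K e h"
  using assms(1)
proof (rule evaluatesE)
  fix p N T
  assume T: "poly_bounded X K T"
    and p: "\<And>a s. a \<in> X \<Longrightarrow> s 0 = e a \<Longrightarrow>
      \<exists>t s'. exec p s t s' \<and> t \<le> T a \<and> s' 0 = g a \<and> (\<forall>x \<ge> N. s' x = s x)"
  from assms(2) show ?thesis
  proof (rule evaluatesE)
    fix q M U
    assume U: "poly_bounded X K U"
      and q: "\<And>a s. a \<in> X \<Longrightarrow> s 0 = g a \<Longrightarrow>
        \<exists>t s'. exec q s t s' \<and> t \<le> U a \<and> s' 0 = h a \<and> (\<forall>x \<ge> M. s' x = s x)"
    show ?thesis
    proof (rule evaluatesI[OF poly_bounded_add[OF T U]])
      fix a and s :: state
      assume a: "a \<in> X" "s 0 = e a"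
      from p[of a s, OF this] obtain t s' where 1: "exec p s t s'" "t \<le> T a" "s' 0 = g a" "\<forall>x\<ge>N. s' x = s x"
        by blast
      from q[of a s', OF a(1) 1(3)] obtain t' s'' where 2: "exec q s' t' s''" "t' \<le> U a" "s'' 0 = h a"
        "\<forall>x\<ge>M. s'' x = s' x"
        by blast
      show "\<exists>t s'. exec (Seq p q) s t s' \<and> t \<le> T a + U a \<and> s' 0 = h a \<and> (\<forall>x \<ge> max N M. s' x = s x)"
        using exec.Seq[OF 1(1) 2(1)] 1 2 by fastforce
    qed
  qed
qed

section \<open>Environments as stacks of let-bound values\<close>

lemma evaluates_env: "evaluates X K e e"
  by (rule evaluates_exp[of _ _ "Var 0"]) simp

lemma evaluates_Atom: "evaluates X K e (\<lambda>_. Atom)"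
  by (rule evaluates_exp[of _ _ "AtomE"]) simp

lemma evaluates_fst: "evaluates X K e g \<Longrightarrow> evaluates X K e (\<lambda>a. fst_data (g a))"
  by (erule evaluates_trans) (rule evaluates_exp[of _ _ "FstE (Var 0)"], simp)

lemma evaluates_snd: "evaluates X K e g \<Longrightarrow> evaluates X K e (\<lambda>a. snd_data (g a))"
  by (erule evaluates_trans) (rule evaluates_exp[of _ _ "SndE (Var 0)"], simp)

lemma evaluates_weaken: "evaluates X K e g \<Longrightarrow> evaluates X K (\<lambda>a. Pair (u a) (e a)) g"
  by (rule evaluates_trans[rotated]) (assumption, rule evaluates_exp[of _ _ "SndE (Var 0)"], simp)

lemma evaluates_head: "evaluates X K (\<lambda>a. Pair (u a) (e a)) u"
  by (rule evaluates_exp[of _ _ "FstE (Var 0)"]) simp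

text \<open>The input is saved in variable N, which the program for g leaves alone, and is paired
  with the result afterwards. The environment thus grows like a stack, whose entries
  \<open>evaluates_head\<close> and \<open>evaluates_weaken\<close> address.\<close>

lemma evaluates_push:
  assumes "evaluates X K e g"
  shows "evaluates X K e (\<lambda>a. Pair (g a) (e a))"
  using assms
proof (rule evaluatesE)
  fix p N T
  assume T: "poly_bounded X K T" and "N > 0"
    and p: "\<And>a s. a \<in> X \<Longrightarrow> s 0 = e a \<Longrightarrow>
      \<exists>t s'. exec p s t s' \<and> t \<le> T a \<and> s' 0 = g a \<and> (\<forall>x \<ge> N. s' x = s x)"
  show ?thesis
  proof (rule evaluatesI)
    show "poly_bounded X K (\<lambda>a. T a + 6)" by (intro poly_bounded_intros T)
    fix a and s :: state
    assume a: "a \<in> X" "s 0 = e a"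
    let ?s = "s(N := val (Var 0) s)"
    have "?s 0 = e a" using a \<open>N > 0\<close> by simp
    from p[of a ?s, OF a(1) this] obtain t s' where 1: "exec p ?s t s'" "t \<le> T a" "s' 0 = g a"
      "\<forall>x\<ge>N. s' x = ?s x"
      by blast
    have "exec (Seq (Assign N (Var 0)) (Seq p (Assign 0 (PairE (Var 0) (Var N))))) s
       (1 + cost (Var 0) + (t + (1 + cost (PairE (Var 0) (Var N)))))
       (s'(0 := val (PairE (Var 0) (Var N)) s'))" (is "exec ?p s ?t ?s'")
      by (rule exec.Seq[OF exec.Assign exec.Seq[OF 1(1) exec.Assign]])
    moreover have "?t \<le> T a + 6" "?s' 0 = Pair (g a) (e a)" "\<forall>x\<ge>Suc N. ?s' x = s x"
      using 1 a by auto
    ultimately show "\<exists>t s'. exec ?p s t s' \<and> t \<le> T a + 6 \<and> s' 0 = Pair (g a) (e a) \<and>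
        (\<forall>x \<ge> Suc N. s' x = s x)"
      by blast
  qed
qed

lemma evaluates_Let:
  "evaluates X K e g \<Longrightarrow> evaluates X K (\<lambda>a. Pair (g a) (e a)) h \<Longrightarrow> evaluates X K e h"
  by (rule evaluates_trans[OF evaluates_push])

lemma evaluates_Pair:
  assumes "evaluates X K e g" "evaluates X K e h"
  shows "evaluates X K e (\<lambda>a. Pair (g a) (h a))"
proof (rule evaluates_Let[OF assms(2)], rule evaluates_Let[OF evaluates_weaken[OF assms(1)]])
  show "evaluates X K (\<lambda>a. Pair (g a) (Pair (h a) (e a))) (\<lambda>a. Pair (g a) (h a))"
    by (rule evaluates_exp[of _ _ "PairE (FstE (Var 0)) (FstE (SndE (Var 0)))"]) simp
qed

text \<open>The condition stays on the stack while a branch runs. Each branch is required to be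
  evaluable on all of X, so its bounds have to hold even where it is not chosen.\<close>

lemma evaluates_If:
  assumes "evaluates X K e b" "evaluates X K e g" "evaluates X K e h"
  shows "evaluates X K e (\<lambda>a. if b a \<noteq> Atom then g a else h a)"
proof (rule evaluates_Let[OF assms(1)])
  let ?e = "\<lambda>a. Pair (b a) (e a)"
  obtain p N T where T: "poly_bounded X K T"
    and p: "\<And>a s. a \<in> X \<Longrightarrow> s 0 = ?e a \<Longrightarrow>
      \<exists>t s'. exec p s t s' \<and> t \<le> T a \<and> s' 0 = g a \<and> (\<forall>x \<ge> N. s' x = s x)"
    using evaluates_weaken[OF assms(2), of b] by (elim evaluatesE) blast
  obtain q M U where U: "poly_bounded X K U"
    and q: "\<And>a s. a \<in> X \<Longrightarrow> s 0 = ?e a \<Longrightarrow>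
      \<exists>t s'. exec q s t s' \<and> t \<le> U a \<and> s' 0 = h a \<and> (\<forall>x \<ge> M. s' x = s x)"
    using evaluates_weaken[OF assms(3), of b] by (elim evaluatesE) blast
  show "evaluates X K ?e (\<lambda>a. if b a \<noteq> Atom then g a else h a)"
  proof (rule evaluatesI)
    show "poly_bounded X K (\<lambda>a. 3 + (T a + U a))" by (intro poly_bounded_intros T U)
    let ?p = "If (FstE (Var 0)) p q"
    fix a and s :: state
    assume a: "a \<in> X" "s 0 = ?e a"
    show "\<exists>t s'. exec ?p s t s' \<and> t \<le> 3 + (T a + U a) \<and>
        s' 0 = (if b a \<noteq> Atom then g a else h a) \<and> (\<forall>x \<ge> max N M. s' x = s x)"
    proof (cases "b a = Atom")
      case True
      from q[of a s, OF a] obtain t s' where 1: "exec q s t s'" "t \<le> U a" "s' 0 = h a"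
        "\<forall>x\<ge>M. s' x = s x"
        by blast
      have "exec ?p s (1 + cost (FstE (Var 0)) + t) s'"
        using a True 1 by (intro exec.IfFalse) auto
      moreover have "1 + cost (FstE (Var 0)) + t \<le> 3 + (T a + U a)" using 1(2) by simp
      ultimately show ?thesis using True 1 by fastforce
    next
      case False
      from p[of a s, OF a] obtain t s' where 1: "exec p s t s'" "t \<le> T a" "s' 0 = g a"
        "\<forall>x\<ge>N. s' x = s x"
        by blast
      have "exec ?p s (1 + cost (FstE (Var 0)) + t) s'"
        using a False 1 by (intro exec.IfTrue) auto
      moreover have "1 + cost (FstE (Var 0)) + t \<le> 3 + (T a + U a)" using 1(2) by simp
      ultimately show ?thesis using False 1 by fastforce
    qed
  qed
qed

text \<open>The loop is described by the sequence \<open>acc a i\<close> of accumulator values, so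
  choosing \<open>acc\<close> amounts to choosing the invariant. The body is a family over pairs (a,
  i) measured by \<open>K a\<close> alone, which provides one program and one time bound for all
  rounds.\<close>

lemma evaluates_fold:
  fixes X :: "'a set" and xs :: "'a \<Rightarrow> data list" and acc :: "'a \<Rightarrow> nat \<Rightarrow> data"
  assumes xs: "evaluates X K e (\<lambda>a. list_data (xs a))"
    and len: "poly_bounded X K (\<lambda>a. length (xs a))"
    and init: "evaluates X K e (\<lambda>a. acc a 0)"
    and step: "evaluates (SIGMA a:X. {..<length (xs a)}) (\<lambda>q. K (fst q))
      (\<lambda>q. Pair (xs (fst q) ! snd q) (Pair (acc (fst q) (snd q)) (e (fst q))))
      (\<lambda>q. acc (fst q) (Suc (snd q)))"
  shows "evaluates X K e (\<lambda>a. acc a (length (xs a)))"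
proof (rule evaluates_Let[OF init], rule evaluates_Let[OF evaluates_weaken[OF xs]])
  obtain p N T where T: "poly_bounded (SIGMA a:X. {..<length (xs a)}) (\<lambda>q. K (fst q)) T" and "N > 0"
    and p: "\<And>q s. q \<in> (SIGMA a:X. {..<length (xs a)}) \<Longrightarrow>
      s 0 = Pair (xs (fst q) ! snd q) (Pair (acc (fst q) (snd q)) (e (fst q))) \<Longrightarrow>
      \<exists>t s'. exec p s t s' \<and> t \<le> T q \<and> s' 0 = acc (fst q) (Suc (snd q)) \<and> (\<forall>x \<ge> N. s' x = s x)"
    using step by (elim evaluatesE) blast
  obtain U where U: "poly_bounded X K U"
    "\<And>a i. a \<in> X \<Longrightarrow> i < length (xs a) \<Longrightarrow> T (a, i) \<le> U a"
    using T by (rule poly_bounded_Max) auto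
  \<comment> \<open>Variable N holds remaining list, accumulator and environment, out of reach of
    the body p. The test \<open>FstE (Var N)\<close> fails exactly at the empty list, since every
    other list is a \<open>Pair\<close>, even if its head is \<open>Atom\<close>.\<close>
  let ?load = "PairE (FstE (FstE (Var N))) (SndE (Var N))"
  let ?store = "PairE (SndE (FstE (Var N))) (PairE (Var 0) (SndE (SndE (Var N))))"
  let ?body = "Seq (Assign 0 ?load) (Seq p (Assign N ?store))"
  let ?loop = "While (FstE (Var N)) ?body"
  \<comment> \<open>Test, load and store cost 3 + 7 + 10 units per round, which the 22 covers; the
    leading 3 pays for the last, failing test.\<close>
  have loop: "\<exists>t s'. exec ?loop s t s' \<and> t \<le> 3 + n * (U a + 22) \<and>
      fst_data (snd_data (s' N)) = acc a (length (xs a)) \<and> (\<forall>x > N. s' x = s x)"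
    if "a \<in> X" "i + n = length (xs a)"
      "s N = Pair (list_data (drop i (xs a))) (Pair (acc a i) (e a))" for a i n s
    using that
  proof (induction n arbitrary: i s)
    case 0
    then have "exec ?loop s (1 + cost (FstE (Var N))) s" by (intro exec.WhileFalse) simp
    with 0 show ?case by (intro exI conjI) auto
  next
    case (Suc n)
    then have i: "i < length (xs a)" by simp
    then have d: "drop i (xs a) = xs a ! i # drop (Suc i) (xs a)" by (rule Cons_nth_drop_Suc[symmetric])
    let ?s = "s(0 := val ?load s)"
    have "(a, i) \<in> (SIGMA a:X. {..<length (xs a)})" using Suc.prems i by simp
    moreover have "?s 0 = Pair (xs (fst (a, i)) ! snd (a, i))
        (Pair (acc (fst (a, i)) (snd (a, i))) (e (fst (a, i))))"
      using Suc.prems d by simp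
    ultimately have "\<exists>t s'. exec p ?s t s' \<and> t \<le> T (a, i) \<and>
        s' 0 = acc (fst (a, i)) (Suc (snd (a, i))) \<and> (\<forall>x \<ge> N. s' x = ?s x)"
      by (rule p)
    then obtain t s' where 1: "exec p ?s t s'" "t \<le> T (a, i)" "s' 0 = acc a (Suc i)"
      "\<forall>x\<ge>N. s' x = ?s x"
      unfolding fst_conv snd_conv by blast
    let ?s' = "s'(N := val ?store s')"
    have "s' N = s N" using 1 \<open>N > 0\<close> by simp
    then have "?s' N = Pair (list_data (drop (Suc i) (xs a))) (Pair (acc a (Suc i)) (e a))"
      using 1 Suc.prems d by simp
    moreover have "Suc i + n = length (xs a)" using Suc.prems by simp
    ultimately obtain t' s'' where 2: "exec ?loop ?s' t' s''" "t' \<le> 3 + n * (U a + 22)"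
      "fst_data (snd_data (s'' N)) = acc a (length (xs a))" "\<forall>x > N. s'' x = ?s' x"
      using Suc.IH[of "Suc i" ?s'] \<open>a \<in> X\<close> by blast
    have "exec ?body s (1 + cost ?load + (t + (1 + cost ?store))) ?s'"
      by (rule exec.Seq[OF exec.Assign exec.Seq[OF 1(1) exec.Assign]])
    then have run: "exec ?loop s (1 + cost (FstE (Var N)) + (1 + cost ?load + (t + (1 + cost ?store))) + t') s''"
      using Suc.prems d by (intro exec.WhileTrue[OF _ _ 2(1)]) auto
    have "t \<le> U a" using 1(2) U(2)[of a i] Suc.prems i by simp
    then have time: "1 + cost (FstE (Var N)) + (1 + cost ?load + (t + (1 + cost ?store))) + t'
        \<le> 3 + Suc n * (U a + 22)"
      using 2(2) by simp
    have "\<forall>x > N. s'' x = s x" using 1(4) 2(4) \<open>N > 0\<close> by simp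
    with run time 2(3) show ?case by blast
  qed
  let ?e = "\<lambda>a. Pair (list_data (xs a)) (Pair (acc a 0) (e a))"
  show "evaluates X K ?e (\<lambda>a. acc a (length (xs a)))"
  proof (rule evaluatesI)
    show "poly_bounded X K (\<lambda>a. 9 + length (xs a) * (U a + 22))"
      by (intro poly_bounded_intros len U)
    let ?p = "Seq (Assign N (Var 0)) (Seq ?loop (Assign 0 (FstE (SndE (Var N)))))"
    fix a and s :: state
    assume a: "a \<in> X" "s 0 = ?e a"
    let ?s = "s(N := val (Var 0) s)"
    obtain t s' where 1: "exec ?loop ?s t s'" "t \<le> 3 + length (xs a) * (U a + 22)"
      "fst_data (snd_data (s' N)) = acc a (length (xs a))" "\<forall>x > N. s' x = ?s x"
      using loop[of a 0 "length (xs a)" ?s] a by auto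
    have "exec ?p s (1 + cost (Var 0) + (t + (1 + cost (FstE (SndE (Var N))))))
        (s'(0 := val (FstE (SndE (Var N))) s'))"
      by (rule exec.Seq[OF exec.Assign exec.Seq[OF 1(1) exec.Assign]])
    moreover have "1 + cost (Var 0) + (t + (1 + cost (FstE (SndE (Var N)))))
        \<le> 9 + length (xs a) * (U a + 22)"
      using 1(2) by simp
    moreover have "(s'(0 := val (FstE (SndE (Var N))) s')) 0 = acc a (length (xs a))"
      using 1(3) by simp
    moreover have "\<forall>x \<ge> Suc N. (s'(0 := val (FstE (SndE (Var N))) s')) x = s x"
      using 1(4) by simp
    ultimately show "\<exists>t s'. exec ?p s t s' \<and> t \<le> 9 + length (xs a) * (U a + 22) \<and>
        s' 0 = acc a (length (xs a)) \<and> (\<forall>x \<ge> Suc N. s' x = s x)"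
      by blast
  qed
qed

section \<open>Lists and numbers\<close>

text \<open>In the body of a fold the stack consists of list element, accumulator and outer
  environment; this reaches the third, \<open>evaluates_acc\<close> the second.\<close>

lemma evaluates_outer:
  "evaluates X K e g \<Longrightarrow> evaluates (Sigma X B) (\<lambda>q. K (fst q))
    (\<lambda>q. Pair (u q) (Pair (v q) (e (fst q)))) (\<lambda>q. g (fst q))"
  by (intro evaluates_weaken evaluates_fst_index)

lemma evaluates_acc: "evaluates X K (\<lambda>q. Pair (u q) (Pair (v q) (w q))) v"
  by (intro evaluates_weaken evaluates_head)

text \<open>Makes counting loops folds over lists, and addition and truncated subtraction instances
  of prepending and dropping.\<close>

lemma num_eq_list_data: "num n = list_data (replicate n Atom)"
  by (induction n) auto

lemma snd_data_list_data: "snd_data (list_data xs) = list_data (tl xs)"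
  by (cases xs) auto

lemma evaluates_drop:
  assumes n: "evaluates X K e (\<lambda>a. num (n a))" "poly_bounded X K n"
    and xs: "evaluates X K e (\<lambda>a. list_data (xs a))"
  shows "evaluates X K e (\<lambda>a. list_data (drop (n a) (xs a)))"
proof -
  have "evaluates X K e (\<lambda>a. list_data (drop (length (replicate (n a) Atom)) (xs a)))"
  proof (rule evaluates_fold[where xs = "\<lambda>a. replicate (n a) Atom"
        and acc = "\<lambda>a i. list_data (drop i (xs a))"])
    show "evaluates (SIGMA a:X. {..<length (replicate (n a) Atom)}) (\<lambda>q. K (fst q))
       (\<lambda>q. Pair (replicate (n (fst q)) Atom ! snd q)
         (Pair (list_data (drop (snd q) (xs (fst q)))) (e (fst q))))
       (\<lambda>q. list_data (drop (Suc (snd q)) (xs (fst q))))"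
      by (rule evaluates_cong[OF evaluates_snd[OF evaluates_acc]])
        (auto simp: snd_data_list_data drop_Suc tl_drop)
  qed (use n xs in \<open>simp_all add: num_eq_list_data\<close>)
  then show ?thesis by simp
qed

lemma evaluates_shift:
  assumes n: "evaluates X K e (\<lambda>a. num (n a))" "poly_bounded X K n"
    and xs: "evaluates X K e (\<lambda>a. list_data (xs a))"
  shows "evaluates X K e (\<lambda>a. list_data (replicate (n a) Atom @ xs a))"
proof -
  have "evaluates X K e (\<lambda>a. list_data (replicate (length (replicate (n a) Atom)) Atom @ xs a))"
  proof (rule evaluates_fold[where xs = "\<lambda>a. replicate (n a) Atom"
        and acc = "\<lambda>a i. list_data (replicate i Atom @ xs a)"])
    show "evaluates (SIGMA a:X. {..<length (replicate (n a) Atom)}) (\<lambda>q. K (fst q))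
       (\<lambda>q. Pair (replicate (n (fst q)) Atom ! snd q)
         (Pair (list_data (replicate (snd q) Atom @ xs (fst q))) (e (fst q))))
       (\<lambda>q. list_data (replicate (Suc (snd q)) Atom @ xs (fst q)))"
      by (rule evaluates_cong[OF evaluates_Pair[OF evaluates_Atom evaluates_acc]]) auto
  qed (use n xs in \<open>simp_all add: num_eq_list_data\<close>)
  then show ?thesis by simp
qed

text \<open>A fold builds its output by consing, hence back to front; this restores the order and
  attaches a tail in one pass.\<close>

lemma evaluates_rev_append:
  assumes xs: "evaluates X K e (\<lambda>a. list_data (xs a))" "poly_bounded X K (\<lambda>a. length (xs a))"
    and ys: "evaluates X K e (\<lambda>a. list_data (ys a))"
  shows "evaluates X K e (\<lambda>a. list_data (rev (xs a) @ ys a))"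
proof -
  have "evaluates X K e (\<lambda>a. list_data (rev (take (length (xs a)) (xs a)) @ ys a))"
  proof (rule evaluates_fold[where xs = xs
        and acc = "\<lambda>a i. list_data (rev (take i (xs a)) @ ys a)"])
    show "evaluates (SIGMA a:X. {..<length (xs a)}) (\<lambda>q. K (fst q))
       (\<lambda>q. Pair (xs (fst q) ! snd q)
         (Pair (list_data (rev (take (snd q) (xs (fst q))) @ ys (fst q))) (e (fst q))))
       (\<lambda>q. list_data (rev (take (Suc (snd q)) (xs (fst q))) @ ys (fst q)))"
      by (rule evaluates_cong[OF evaluates_Pair[OF evaluates_head evaluates_acc]])
        (auto simp: take_Suc_conv_app_nth)
  qed (use xs ys in simp_all)
  then show ?thesis by simp
qed

lemma evaluates_Suc:
  "evaluates X K e (\<lambda>a. num (n a)) \<Longrightarrow> evaluates X K e (\<lambda>a. num (Suc (n a)))"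
  using evaluates_Pair[OF evaluates_Atom] by fastforce

lemma evaluates_length:
  assumes "evaluates X K e (\<lambda>a. list_data (xs a))" "poly_bounded X K (\<lambda>a. length (xs a))"
  shows "evaluates X K e (\<lambda>a. num (length (xs a)))"
  by (rule evaluates_fold[where acc = "\<lambda>_. num", OF assms])
    (simp add: evaluates_Atom, rule evaluates_Suc[OF evaluates_acc])

lemma evaluates_add:
  assumes "evaluates X K e (\<lambda>a. num (m a))" "poly_bounded X K m"
    and "evaluates X K e (\<lambda>a. num (n a))"
  shows "evaluates X K e (\<lambda>a. num (m a + n a))"
proof -
  have "evaluates X K e (\<lambda>a. list_data (replicate (n a) Atom))"
    using assms(3) by (simp add: num_eq_list_data)
  with assms(1,2) show ?thesis
    by (simp add: num_eq_list_data[of "_ + _"] replicate_add evaluates_shift)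
qed

lemma evaluates_diff:
  assumes "evaluates X K e (\<lambda>a. num (m a))"
    and "evaluates X K e (\<lambda>a. num (n a))" "poly_bounded X K n"
  shows "evaluates X K e (\<lambda>a. num (m a - n a))"
proof -
  have "evaluates X K e (\<lambda>a. list_data (replicate (m a) Atom))"
    using assms(1) by (simp add: num_eq_list_data)
  from evaluates_drop[OF assms(2,3) this] show ?thesis
    by (simp add: num_eq_list_data)
qed

lemma evaluates_times:
  assumes m: "evaluates X K e (\<lambda>a. num (m a))" "poly_bounded X K m"
    and n: "evaluates X K e (\<lambda>a. num (n a))" "poly_bounded X K n"
  shows "evaluates X K e (\<lambda>a. num (m a * n a))"
proof -
  have "evaluates X K e (\<lambda>a. num (length (replicate (m a) Atom) * n a))"
  proof (rule evaluates_fold[where xs = "\<lambda>a. replicate (m a) Atom"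
        and acc = "\<lambda>a i. num (i * n a)"])
    show "evaluates (SIGMA a:X. {..<length (replicate (m a) Atom)}) (\<lambda>q. K (fst q))
       (\<lambda>q. Pair (replicate (m (fst q)) Atom ! snd q) (Pair (num (snd q * n (fst q))) (e (fst q))))
       (\<lambda>q. num (Suc (snd q) * n (fst q)))"
      unfolding mult_Suc
      by (rule evaluates_add[OF evaluates_outer[OF n(1)] poly_bounded_fst[OF n(2)] evaluates_acc])
  qed (use m evaluates_Atom in \<open>simp_all add: num_eq_list_data[symmetric]\<close>)
  then show ?thesis by simp
qed

text \<open>The bound \<open>bn\<close> on the result is a hypothesis because powers are not
  polynomial in base and exponent; through it the exponential dependence on the parameter enters. As
  b is positive, it also covers the intermediate powers.\<close>

lemma evaluates_power:
  assumes b: "evaluates X K e (\<lambda>a. num (b a))" "poly_bounded X K b" "\<And>a. a \<in> X \<Longrightarrow> b a > 0"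
    and n: "evaluates X K e (\<lambda>a. num (n a))" "poly_bounded X K n"
    and bn: "poly_bounded X K (\<lambda>a. b a ^ n a)"
  shows "evaluates X K e (\<lambda>a. num (b a ^ n a))"
proof -
  have "evaluates X K e (\<lambda>a. num (b a ^ length (replicate (n a) Atom)))"
  proof (rule evaluates_fold[where xs = "\<lambda>a. replicate (n a) Atom"
        and acc = "\<lambda>a i. num (b a ^ i)"])
    have "poly_bounded (SIGMA a:X. {..<length (replicate (n a) Atom)}) (\<lambda>q. K (fst q))
        (\<lambda>q. b (fst q) ^ snd q)"
      using poly_bounded_fst[OF bn]
      by (rule poly_bounded_mono) (auto intro!: power_increasing simp: Suc_le_eq b(3))
    then show "evaluates (SIGMA a:X. {..<length (replicate (n a) Atom)}) (\<lambda>q. K (fst q))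
       (\<lambda>q. Pair (replicate (n (fst q)) Atom ! snd q) (Pair (num (b (fst q) ^ snd q)) (e (fst q))))
       (\<lambda>q. num (b (fst q) ^ Suc (snd q)))"
      unfolding power_Suc
      by (intro evaluates_times evaluates_acc evaluates_outer[OF b(1)] poly_bounded_fst[OF b(2)])
  qed (use n evaluates_Suc[OF evaluates_Atom[of X K e, folded num.simps(1)]]
       in \<open>simp_all add: num_eq_list_data[symmetric]\<close>)
  then show ?thesis by simp
qed

section \<open>Bit tables\<close>

text \<open>A bit list stands for the set of positions that hold True. Past its end every bit counts
  as unset, so tables of different lengths need no padding.\<close>

definition bit_at :: "bool list \<Rightarrow> nat \<Rightarrow> bool" where
  "bit_at xs i \<longleftrightarrow> i < length xs \<and> xs ! i"

definition or_bits :: "bool list \<Rightarrow> bool list \<Rightarrow> bool list" where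
  "or_bits xs ys = map (\<lambda>i. bit_at xs i \<or> bit_at ys i) [0..<max (length xs) (length ys)]"

lemma length_or_bits [simp]: "length (or_bits xs ys) = max (length xs) (length ys)"
  by (simp add: or_bits_def)

lemma bit_at_or_bits [simp]: "bit_at (or_bits xs ys) i \<longleftrightarrow> bit_at xs i \<or> bit_at ys i"
  by (auto simp: or_bits_def bit_at_def)

lemma bit_at_drop [simp]: "bit_at (drop n xs) i \<longleftrightarrow> bit_at xs (n + i)"
  by (auto simp: bit_at_def)

lemma bit_at_shift [simp]: "bit_at (replicate n False @ xs) i \<longleftrightarrow> n \<le> i \<and> bit_at xs (i - n)"
  by (auto simp: bit_at_def nth_append)

lemma bit_at_Nil [simp]: "\<not> bit_at [] i"
  by (simp add: bit_at_def)

lemma bit_at_singleton [simp]: "bit_at [b] i \<longleftrightarrow> i = 0 \<and> b"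
  by (auto simp: bit_at_def)

lemma bit_eq_Atom_iff [simp]: "bit b = Atom \<longleftrightarrow> \<not> b"
  by (simp add: bit_def)

lemma evaluates_True: "evaluates X K e (\<lambda>_. bit True)"
  using evaluates_Pair[OF evaluates_Atom evaluates_Atom] by (simp add: bit_def)

lemma evaluates_If_bit:
  assumes "evaluates X K e (\<lambda>a. bit (b a))" "evaluates X K e g" "evaluates X K e h"
  shows "evaluates X K e (\<lambda>a. if b a then g a else h a)"
  using evaluates_If[OF assms] by simp

lemma evaluates_disj:
  assumes "evaluates X K e (\<lambda>a. bit (b a))" "evaluates X K e (\<lambda>a. bit (c a))"
  shows "evaluates X K e (\<lambda>a. bit (b a \<or> c a))"
  by (rule evaluates_cong[OF evaluates_If_bit[OF assms(1) evaluates_True assms(2)]]) auto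

text \<open>Trees cannot be compared, but truncated subtraction leaves \<open>Atom\<close> exactly
  if m \<le> n.\<close>

lemma evaluates_le:
  assumes "evaluates X K e (\<lambda>a. num (m a))"
    and "evaluates X K e (\<lambda>a. num (n a))" "poly_bounded X K n"
  shows "evaluates X K e (\<lambda>a. bit (m a \<le> n a))"
proof (rule evaluates_cong[OF evaluates_If[OF evaluates_diff[OF assms] evaluates_Atom evaluates_True]])
  have "num k = Atom \<longleftrightarrow> k = 0" for k by (cases k) auto
  then show "(if num (m a - n a) \<noteq> Atom then Atom else bit True) = bit (m a \<le> n a)" for a
    by (auto simp: bit_def)
qed simp

text \<open>Off the end, \<open>fst_data Atom\<close> is \<open>Atom\<close>, which is also
  \<open>bit False\<close>; hence lookup needs no bounds check.\<close>

lemma fst_data_drop_bits: "fst_data (list_data (drop i (map bit xs))) = bit (bit_at xs i)"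
proof (cases "i < length xs")
  case True
  then show ?thesis by (simp add: Cons_nth_drop_Suc[symmetric] drop_map bit_at_def)
next
  case False
  then show ?thesis by (simp add: bit_at_def bit_def)
qed

lemma evaluates_bit_at:
  assumes "evaluates X K e (\<lambda>a. list_data (map bit (xs a)))"
    and "evaluates X K e (\<lambda>a. num (n a))" "poly_bounded X K n"
  shows "evaluates X K e (\<lambda>a. bit (bit_at (xs a) (n a)))"
  using evaluates_fst[OF evaluates_drop[OF assms(2,3,1)]] by (simp add: fst_data_drop_bits)

lemma evaluates_shift_bits:
  assumes "evaluates X K e (\<lambda>a. num (n a))" "poly_bounded X K n"
    and "evaluates X K e (\<lambda>a. list_data (map bit (xs a)))"
  shows "evaluates X K e (\<lambda>a. list_data (map bit (replicate (n a) False @ xs a)))"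
  using evaluates_shift[OF assms] by (simp add: bit_def)

lemma evaluates_drop_bits:
  assumes "evaluates X K e (\<lambda>a. num (n a))" "poly_bounded X K n"
    and "evaluates X K e (\<lambda>a. list_data (map bit (xs a)))"
  shows "evaluates X K e (\<lambda>a. list_data (map bit (drop (n a) (xs a))))"
  using evaluates_drop[OF assms] by (simp add: drop_map)

text \<open>One pass over \<open>ys\<close> consumes \<open>xs\<close> in step and collects the
  output in reverse. If \<open>xs\<close> ends early, its missing bits read as unset; if it is
  longer, its remainder is appended. The number of rounds is the length of
  \<open>ys\<close>.\<close>

lemma evaluates_or_bits:
  assumes xs: "evaluates X K e (\<lambda>a. list_data (map bit (xs a)))"
    and ys: "evaluates X K e (\<lambda>a. list_data (map bit (ys a)))"
    and len: "poly_bounded X K (\<lambda>a. length (ys a))"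
  shows "evaluates X K e (\<lambda>a. list_data (map bit (or_bits (xs a) (ys a))))"
proof -
  let ?out = "\<lambda>a i. map (\<lambda>j. bit_at (xs a) j \<or> bit_at (ys a) j) [0..<i]"
  let ?acc = "\<lambda>a i. Pair (list_data (drop i (map bit (xs a)))) (list_data (rev (map bit (?out a i))))"
  have acc: "evaluates X K e (\<lambda>a. ?acc a (length (map bit (ys a))))"
  proof (rule evaluates_fold[where acc = ?acc])
    let ?Y = "SIGMA a:X. {..<length (map bit (ys a))}"
    let ?e = "\<lambda>q. Pair (map bit (ys (fst q)) ! snd q) (Pair (?acc (fst q) (snd q)) (e (fst q)))"
    have 1: "evaluates ?Y (\<lambda>q. K (fst q)) ?e (\<lambda>q. list_data (drop (snd q) (map bit (xs (fst q)))))"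
      by (rule evaluates_cong[OF evaluates_fst[OF evaluates_acc]]) (simp, simp)
    have 2: "evaluates ?Y (\<lambda>q. K (fst q)) ?e (\<lambda>q. list_data (rev (map bit (?out (fst q) (snd q)))))"
      by (rule evaluates_cong[OF evaluates_snd[OF evaluates_acc]]) (simp, simp)
    have 3: "evaluates ?Y (\<lambda>q. K (fst q)) ?e (\<lambda>q. bit (bit_at (ys (fst q)) (snd q)))"
      by (rule evaluates_cong[OF evaluates_head]) (auto simp: bit_at_def)
    have 4: "evaluates ?Y (\<lambda>q. K (fst q)) ?e (\<lambda>q. bit (bit_at (xs (fst q)) (snd q)))"
      using evaluates_fst[OF 1] by (simp add: fst_data_drop_bits)
    have "evaluates ?Y (\<lambda>q. K (fst q)) ?e (\<lambda>q. Pair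
        (snd_data (list_data (drop (snd q) (map bit (xs (fst q))))))
        (Pair (bit (bit_at (xs (fst q)) (snd q) \<or> bit_at (ys (fst q)) (snd q)))
          (list_data (rev (map bit (?out (fst q) (snd q)))))))"
      by (intro evaluates_Pair evaluates_disj evaluates_snd 1 2 3 4)
    then show "evaluates ?Y (\<lambda>q. K (fst q)) ?e (\<lambda>q. ?acc (fst q) (Suc (snd q)))"
      by (rule evaluates_cong) (auto simp: snd_data_list_data drop_Suc tl_drop)
    show "evaluates X K e (\<lambda>a. ?acc a 0)"
      using evaluates_Pair[OF xs evaluates_Atom] by simp
  qed (use ys len in simp_all)
  have out: "evaluates X K e (\<lambda>a. list_data (rev (map bit (?out a (length (ys a))))))"
    using evaluates_snd[OF acc] by simp
  have rest: "evaluates X K e (\<lambda>a. list_data (drop (length (ys a)) (map bit (xs a))))"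
    using evaluates_fst[OF acc] by simp
  have "poly_bounded X K (\<lambda>a. length (rev (map bit (?out a (length (ys a))))))"
    using len by simp
  from evaluates_rev_append[OF out this rest] show ?thesis
  proof (rule evaluates_cong)
    fix a
    have "?out a (length (ys a)) @ drop (length (ys a)) (xs a) = or_bits (xs a) (ys a)"
      by (rule nth_equalityI) (auto simp: or_bits_def nth_append bit_at_def)
    then show "list_data (rev (rev (map bit (?out a (length (ys a))))) @
        drop (length (ys a)) (map bit (xs a))) = list_data (map bit (or_bits (xs a) (ys a)))"
      by (metis drop_map map_append rev_rev_ident)
  qed simp
qed

section \<open>The algorithm\<close>

text \<open>Only the digits for the inhabitants, each given by home position and approved numbers;
  \<open>reach\<close> adds the leading summand that counts the vertex itself.\<close>

definition weight :: "nat \<Rightarrow> bool list \<Rightarrow> (nat \<times> nat list) list \<Rightarrow> nat" where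
  "weight b row hs = (\<Sum>j<length hs. if bit_at row (fst (hs ! j)) then b ^ j else 0)"

primrec reach :: "nat \<Rightarrow> bool list list \<Rightarrow> (nat \<times> nat list) list \<Rightarrow> nat \<Rightarrow> bool list" where
  "reach b rows hs 0 = [True]"
| "reach b rows hs (Suc i) =
    (if \<exists>h\<in>set hs. fst h = i then reach b rows hs i
     else or_bits (reach b rows hs i)
       (replicate (weight b (rows ! i) hs + b ^ length hs) False @ reach b rows hs i))"

text \<open>Approved numbers above r are skipped: r refugees cannot attain them, and they are not
  digits in base r + 1. The factor p is the place value of the digit being removed.\<close>

primrec descend :: "nat \<Rightarrow> nat \<Rightarrow> nat list \<Rightarrow> bool list \<Rightarrow> nat \<Rightarrow> bool list" where
  "descend r p ns xs 0 = []"
| "descend r p ns xs (Suc l) =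
    (if ns ! l \<le> r then or_bits (descend r p ns xs l) (drop (ns ! l * p) xs)
     else descend r p ns xs l)"

primrec remaining :: "nat \<Rightarrow> bool list \<Rightarrow> (nat \<times> nat list) list \<Rightarrow> nat \<Rightarrow> bool list" where
  "remaining r xs hs 0 = xs"
| "remaining r xs hs (Suc j) =
    descend r (Suc r ^ j) (snd (hs ! j)) (remaining r xs hs j) (length (snd (hs ! j)))"

definition housing_test :: "nat \<Rightarrow> bool list list \<Rightarrow> (nat \<times> nat list) list \<Rightarrow> bool" where
  "housing_test r rows hs \<longleftrightarrow>
    bit_at (remaining r (reach (Suc r) rows hs (length rows)) hs (length hs)) (r * Suc r ^ length hs)"

lemma weight_le: "b > 0 \<Longrightarrow> weight b row hs \<le> length hs * b ^ length hs"
  unfolding weight_def by (rule order_trans[OF sum_bounded_above[where K = "b ^ length hs"]])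
    (auto intro: power_increasing)

text \<open>Per vertex the shift is at most \<open>length hs * b ^ length hs\<close> for the lower
  digits, plus \<open>b ^ length hs\<close> for the leading one.\<close>

lemma length_reach:
  assumes "b > 0"
  shows "length (reach b rows hs i) \<le> 1 + i * ((length hs + 1) * b ^ length hs)"
proof (induction i)
  case (Suc i)
  then show ?case using weight_le[OF assms, of "rows ! i" hs] by (simp add: algebra_simps)
qed simp

text \<open>Shifting back only drops bits, so the size bound for \<open>reach\<close> persists
  through all later rounds.\<close>

lemma length_descend: "length (descend r p ns xs l) \<le> length xs"
  by (induction l) auto

lemma length_remaining: "length (remaining r xs hs j) \<le> length xs"
  by (induction j) (auto intro: order_trans[OF length_descend])

section \<open>The steps of the algorithm as programs\<close>

definition inhabitant_data :: "nat \<times> nat list \<Rightarrow> data" where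
  "inhabitant_data h = Pair (num (fst h)) (list_data (map num (snd h)))"

lemma evaluates_weight:
  assumes row: "evaluates X K e (\<lambda>a. list_data (map bit (row a)))"
    and hs: "evaluates X K e (\<lambda>a. list_data (map inhabitant_data (hs a)))"
    and len: "poly_bounded X K (\<lambda>a. length (hs a))"
    and pos: "poly_bounded X K m" "\<And>a h. a \<in> X \<Longrightarrow> h \<in> set (hs a) \<Longrightarrow> fst h \<le> m a"
    and b: "evaluates X K e (\<lambda>a. num (b a))" "poly_bounded X K b" "\<And>a. a \<in> X \<Longrightarrow> b a > 0"
    and bl: "poly_bounded X K (\<lambda>a. b a ^ length (hs a))"
  shows "evaluates X K e (\<lambda>a. num (weight (b a) (row a) (hs a)))"
proof -
  define w where "w a i = (\<Sum>j<i. if bit_at (row a) (fst (hs a ! j)) then b a ^ j else 0)" for a i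
  have "evaluates X K e (\<lambda>a. Pair (num (b a ^ length (map inhabitant_data (hs a))))
      (num (w a (length (map inhabitant_data (hs a))))))"
  proof (rule evaluates_fold[where acc = "\<lambda>a i. Pair (num (b a ^ i)) (num (w a i))"])
    let ?Y = "SIGMA a:X. {..<length (map inhabitant_data (hs a))}"
    let ?e = "\<lambda>q. Pair (map inhabitant_data (hs (fst q)) ! snd q)
      (Pair (Pair (num (b (fst q) ^ snd q)) (num (w (fst q) (snd q)))) (e (fst q)))"
    let ?h = "\<lambda>q. hs (fst q) ! snd q"
    have bj: "poly_bounded ?Y (\<lambda>q. K (fst q)) (\<lambda>q. b (fst q) ^ snd q)"
      using poly_bounded_fst[OF bl] by (rule poly_bounded_mono) (auto intro!: power_increasing simp: Suc_le_eq b(3))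
    have 1: "evaluates ?Y (\<lambda>q. K (fst q)) ?e (\<lambda>q. num (b (fst q) ^ snd q))"
      by (rule evaluates_cong[OF evaluates_fst[OF evaluates_acc]]) (simp, simp)
    have 2: "evaluates ?Y (\<lambda>q. K (fst q)) ?e (\<lambda>q. num (w (fst q) (snd q)))"
      by (rule evaluates_cong[OF evaluates_snd[OF evaluates_acc]]) (simp, simp)
    have 3: "evaluates ?Y (\<lambda>q. K (fst q)) ?e (\<lambda>q. num (fst (?h q)))"
      by (rule evaluates_cong[OF evaluates_fst[OF evaluates_head]]) (auto simp: inhabitant_data_def)
    have "poly_bounded ?Y (\<lambda>q. K (fst q)) (\<lambda>q. fst (?h q))"
      using poly_bounded_fst[OF pos(1)] by (rule poly_bounded_mono) (auto intro: pos(2))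
    then have 4: "evaluates ?Y (\<lambda>q. K (fst q)) ?e (\<lambda>q. bit (bit_at (row (fst q)) (fst (?h q))))"
      by (rule evaluates_bit_at[OF evaluates_outer[OF row] 3])
    have "evaluates ?Y (\<lambda>q. K (fst q)) ?e (\<lambda>q. Pair (num (b (fst q) * b (fst q) ^ snd q))
        (if bit_at (row (fst q)) (fst (?h q)) then num (b (fst q) ^ snd q + w (fst q) (snd q))
         else num (w (fst q) (snd q))))"
      by (intro evaluates_Pair evaluates_If_bit evaluates_times evaluates_add 1 2 4 bj
          evaluates_outer[OF b(1)] poly_bounded_fst[OF b(2)])
    then show "evaluates ?Y (\<lambda>q. K (fst q)) ?e
        (\<lambda>q. Pair (num (b (fst q) ^ Suc (snd q))) (num (w (fst q) (Suc (snd q)))))"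
      by (rule evaluates_cong) (auto simp: w_def add.commute)
    show "evaluates X K e (\<lambda>a. Pair (num (b a ^ 0)) (num (w a 0)))"
      using evaluates_Pair[OF evaluates_True evaluates_Atom] by (simp add: w_def bit_def)
  qed (use hs len in simp_all)
  from evaluates_snd[OF this] show ?thesis by (simp add: w_def weight_def)
qed

text \<open>The marker is a table whose only set bit is at \<open>i a\<close>; positions beyond its
  end read as unset and so count as different from \<open>i a\<close>.\<close>

lemma evaluates_occupied:
  assumes marker: "evaluates X K e (\<lambda>a. list_data (map bit (replicate (i a) False @ [True])))"
    and hs: "evaluates X K e (\<lambda>a. list_data (map inhabitant_data (hs a)))"
    and len: "poly_bounded X K (\<lambda>a. length (hs a))"
    and pos: "poly_bounded X K m" "\<And>a h. a \<in> X \<Longrightarrow> h \<in> set (hs a) \<Longrightarrow> fst h \<le> m a"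
  shows "evaluates X K e (\<lambda>a. bit (\<exists>h\<in>set (hs a). fst h = i a))"
proof -
  define o' where "o' a l \<longleftrightarrow> (\<exists>j<l. fst (hs a ! j) = i a)" for a l
  have "evaluates X K e (\<lambda>a. bit (o' a (length (map inhabitant_data (hs a)))))"
  proof (rule evaluates_fold[where acc = "\<lambda>a l. bit (o' a l)"])
    let ?Y = "SIGMA a:X. {..<length (map inhabitant_data (hs a))}"
    let ?e = "\<lambda>q. Pair (map inhabitant_data (hs (fst q)) ! snd q)
      (Pair (bit (o' (fst q) (snd q))) (e (fst q)))"
    let ?h = "\<lambda>q. hs (fst q) ! snd q"
    have 1: "evaluates ?Y (\<lambda>q. K (fst q)) ?e (\<lambda>q. num (fst (?h q)))"
      by (rule evaluates_cong[OF evaluates_fst[OF evaluates_head]]) (auto simp: inhabitant_data_def)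
    have "poly_bounded ?Y (\<lambda>q. K (fst q)) (\<lambda>q. fst (?h q))"
      using poly_bounded_fst[OF pos(1)] by (rule poly_bounded_mono) (auto intro: pos(2))
    then have 2: "evaluates ?Y (\<lambda>q. K (fst q)) ?e
        (\<lambda>q. bit (bit_at (replicate (i (fst q)) False @ [True]) (fst (?h q))))"
      by (rule evaluates_bit_at[OF evaluates_outer[OF marker] 1])
    show "evaluates ?Y (\<lambda>q. K (fst q)) ?e (\<lambda>q. bit (o' (fst q) (Suc (snd q))))"
      by (rule evaluates_cong[OF evaluates_disj[OF evaluates_acc 2]])
        (auto simp: o'_def less_Suc_eq intro!: arg_cong[of _ _ bit])
    show "evaluates X K e (\<lambda>a. bit (o' a 0))"
      using evaluates_Atom by (simp add: o'_def bit_def)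
  qed (use hs len in simp_all)
  moreover have "o' a (length (map inhabitant_data (hs a))) \<longleftrightarrow> (\<exists>h\<in>set (hs a). fst h = i a)" for a
    unfolding o'_def by (metis in_set_conv_nth length_map)
  ultimately show ?thesis by simp
qed

lemma evaluates_reach:
  assumes rows: "evaluates X K e (\<lambda>a. list_data (map (\<lambda>row. list_data (map bit row)) (rows a)))"
      "poly_bounded X K (\<lambda>a. length (rows a))"
    and hs: "evaluates X K e (\<lambda>a. list_data (map inhabitant_data (hs a)))"
    and len: "poly_bounded X K (\<lambda>a. length (hs a))"
    and pos: "poly_bounded X K m" "\<And>a h. a \<in> X \<Longrightarrow> h \<in> set (hs a) \<Longrightarrow> fst h \<le> m a"
    and b: "evaluates X K e (\<lambda>a. num (b a))" "poly_bounded X K b" "\<And>a. a \<in> X \<Longrightarrow> b a > 0"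
    and bl: "poly_bounded X K (\<lambda>a. b a ^ length (hs a))"
  shows "evaluates X K e (\<lambda>a. list_data (map bit (reach (b a) (rows a) (hs a) (length (rows a)))))"
proof -
  let ?rows = "\<lambda>a. map (\<lambda>row. list_data (map bit row)) (rows a)"
  let ?T = "\<lambda>a. reach (b a) (rows a) (hs a)"
  \<comment> \<open>With the index \<open>i\<close> written as a marker, testing a position for \<open>= i\<close> is a table lookup.\<close>
  let ?M = "\<lambda>i. replicate i False @ [True]"
  let ?acc = "\<lambda>a i. Pair (list_data (map bit (?M i))) (list_data (map bit (?T a i)))"
  have "evaluates X K e (\<lambda>a. ?acc a (length (?rows a)))"
  proof (rule evaluates_fold[where acc = ?acc])
    let ?Y = "SIGMA a:X. {..<length (?rows a)}"
    let ?e = "\<lambda>q. Pair (?rows (fst q) ! snd q) (Pair (?acc (fst q) (snd q)) (e (fst q)))"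
    let ?K = "\<lambda>q. K (fst q)"
    have M: "evaluates ?Y ?K ?e (\<lambda>q. list_data (map bit (?M (snd q))))"
      by (rule evaluates_cong[OF evaluates_fst[OF evaluates_acc]]) (simp, simp)
    have T: "evaluates ?Y ?K ?e (\<lambda>q. list_data (map bit (?T (fst q) (snd q))))"
      by (rule evaluates_cong[OF evaluates_snd[OF evaluates_acc]]) (simp, simp)
    have row: "evaluates ?Y ?K ?e (\<lambda>q. list_data (map bit (rows (fst q) ! snd q)))"
      by (rule evaluates_cong[OF evaluates_head]) auto
    have hs': "evaluates ?Y ?K ?e (\<lambda>q. list_data (map inhabitant_data (hs (fst q))))"
      by (rule evaluates_outer[OF hs])
    have len': "poly_bounded ?Y ?K (\<lambda>q. length (hs (fst q)))"
      by (rule poly_bounded_fst[OF len])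
    have b': "evaluates ?Y ?K ?e (\<lambda>q. num (b (fst q)))" "poly_bounded ?Y ?K (\<lambda>q. b (fst q))"
      by (rule evaluates_outer[OF b(1)], rule poly_bounded_fst[OF b(2)])
    have bl': "poly_bounded ?Y ?K (\<lambda>q. b (fst q) ^ length (hs (fst q)))"
      by (rule poly_bounded_fst[OF bl])
    have pos': "poly_bounded ?Y ?K (\<lambda>q. m (fst q))"
      by (rule poly_bounded_fst[OF pos(1)])
    have pow: "evaluates ?Y ?K ?e (\<lambda>q. num (b (fst q) ^ length (hs (fst q))))"
    proof (rule evaluates_power[OF b' _ _ len' bl'])
      show "evaluates ?Y ?K ?e (\<lambda>q. num (length (hs (fst q))))"
        using evaluates_length[OF hs'] len' by simp
    qed (auto simp: b(3))
    let ?w = "\<lambda>q. weight (b (fst q)) (rows (fst q) ! snd q) (hs (fst q))"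
    have w: "evaluates ?Y ?K ?e (\<lambda>q. num (?w q))"
      by (rule evaluates_weight[OF row hs' len' pos' _ b' _ bl']) (auto simp: b(3) dest: pos(2))
    have wb: "poly_bounded ?Y ?K ?w"
      by (rule poly_bounded_mono[OF poly_bounded_mult[OF len' bl']])
        (auto intro!: weight_le simp: b(3))
    have wpb: "poly_bounded ?Y ?K (\<lambda>q. ?w q + b (fst q) ^ length (hs (fst q)))"
      by (rule poly_bounded_add[OF wb bl'])
    \<comment> \<open>The tables grow with the index; replacing the index by the number of all rows
      gives a bound in terms of \<open>fst q\<close> alone.\<close>
    have Tb: "poly_bounded ?Y ?K (\<lambda>q. length (?T (fst q) (snd q)))"
    proof (rule poly_bounded_mono)
      show "poly_bounded ?Y ?K (\<lambda>q. 1 + length (rows (fst q)) *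
          ((length (hs (fst q)) + 1) * b (fst q) ^ length (hs (fst q))))"
        by (intro poly_bounded_add poly_bounded_mult poly_bounded_const len' bl'
            poly_bounded_fst[OF rows(2)])
      fix q assume q: "q \<in> ?Y"
      then have "length (?T (fst q) (snd q)) \<le>
          1 + snd q * ((length (hs (fst q)) + 1) * b (fst q) ^ length (hs (fst q)))"
        using b(3) by (intro length_reach) auto
      also have "\<dots> \<le> 1 + length (rows (fst q)) *
          ((length (hs (fst q)) + 1) * b (fst q) ^ length (hs (fst q)))"
        using q by (intro add_left_mono mult_right_mono) auto
      finally show "length (?T (fst q) (snd q)) \<le> \<dots>" .
    qed
    have occ: "evaluates ?Y ?K ?e (\<lambda>q. bit (\<exists>h\<in>set (hs (fst q)). fst h = snd q))"
      by (rule evaluates_occupied[OF M hs' len' pos']) (auto dest: pos(2))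
    let ?shifted = "\<lambda>q. replicate (?w q + b (fst q) ^ length (hs (fst q))) False @ ?T (fst q) (snd q)"
    have shifted: "evaluates ?Y ?K ?e (\<lambda>q. list_data (map bit (?shifted q)))"
      by (rule evaluates_shift_bits[OF evaluates_add[OF w wb pow] wpb T])
    have "poly_bounded ?Y ?K (\<lambda>q. length (?shifted q))"
      using poly_bounded_add[OF wpb Tb] by simp
    \<comment> \<open>Prepending \<open>Atom\<close>, that is \<open>bit False\<close>, moves the
      marker from i to i + 1.\<close>
    then have "evaluates ?Y ?K ?e (\<lambda>q. Pair (Pair Atom (list_data (map bit (?M (snd q)))))
       (if \<exists>h\<in>set (hs (fst q)). fst h = snd q then list_data (map bit (?T (fst q) (snd q)))
        else list_data (map bit (or_bits (?T (fst q) (snd q)) (?shifted q)))))"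
      by (rule evaluates_Pair[OF evaluates_Pair[OF evaluates_Atom M]
            evaluates_If_bit[OF occ T evaluates_or_bits[OF T shifted]]])
    then show "evaluates ?Y ?K ?e (\<lambda>q. ?acc (fst q) (Suc (snd q)))"
      by (rule evaluates_cong) (auto simp: bit_def)
    show "evaluates X K e (\<lambda>a. ?acc a 0)"
      using evaluates_Pair[OF evaluates_Pair[OF evaluates_True evaluates_Atom]
          evaluates_Pair[OF evaluates_True evaluates_Atom]] by simp
  qed (use rows in simp_all)
  from evaluates_snd[OF this] show ?thesis by simp
qed

text \<open>The case distinction asks for the shift by n * p to be evaluable also where n > r; hence
  the bound \<open>m\<close> on all approved numbers.\<close>

lemma evaluates_descend:
  assumes r: "evaluates X K e (\<lambda>a. num (r a))" "poly_bounded X K r"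
    and p: "evaluates X K e (\<lambda>a. num (p a))" "poly_bounded X K p"
    and ns: "evaluates X K e (\<lambda>a. list_data (map num (ns a)))" "poly_bounded X K (\<lambda>a. length (ns a))"
    and m: "poly_bounded X K m" "\<And>a n. a \<in> X \<Longrightarrow> n \<in> set (ns a) \<Longrightarrow> n \<le> m a"
    and xs: "evaluates X K e (\<lambda>a. list_data (map bit (xs a)))" "poly_bounded X K (\<lambda>a. length (xs a))"
  shows "evaluates X K e (\<lambda>a. list_data (map bit (descend (r a) (p a) (ns a) (xs a) (length (ns a)))))"
proof -
  let ?D = "\<lambda>a. descend (r a) (p a) (ns a) (xs a)"
  have "evaluates X K e (\<lambda>a. list_data (map bit (?D a (length (map num (ns a))))))"
  proof (rule evaluates_fold[where acc = "\<lambda>a i. list_data (map bit (?D a i))"])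
    let ?Y = "SIGMA a:X. {..<length (map num (ns a))}"
    let ?e = "\<lambda>q. Pair (map num (ns (fst q)) ! snd q)
      (Pair (list_data (map bit (?D (fst q) (snd q)))) (e (fst q)))"
    let ?K = "\<lambda>q. K (fst q)"
    let ?n = "\<lambda>q. ns (fst q) ! snd q"
    have n: "evaluates ?Y ?K ?e (\<lambda>q. num (?n q))"
      by (rule evaluates_cong[OF evaluates_head]) auto
    have nb: "poly_bounded ?Y ?K ?n"
      using poly_bounded_fst[OF m(1)] by (rule poly_bounded_mono) (auto intro: m(2))
    have "poly_bounded ?Y ?K (\<lambda>q. length (drop (?n q * p (fst q)) (xs (fst q))))"
      using poly_bounded_fst[OF xs(2)] by (rule poly_bounded_mono) simp
    then have "evaluates ?Y ?K ?e (\<lambda>q. if ?n q \<le> r (fst q)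
        then list_data (map bit (or_bits (?D (fst q) (snd q)) (drop (?n q * p (fst q)) (xs (fst q)))))
        else list_data (map bit (?D (fst q) (snd q))))"
      by (intro evaluates_If_bit evaluates_le evaluates_or_bits evaluates_drop_bits evaluates_times
          poly_bounded_mult n nb evaluates_acc evaluates_outer[OF r(1)] evaluates_outer[OF p(1)]
          evaluates_outer[OF xs(1)] poly_bounded_fst[OF r(2)] poly_bounded_fst[OF p(2)])
    then show "evaluates ?Y ?K ?e (\<lambda>q. list_data (map bit (?D (fst q) (Suc (snd q)))))"
      by (rule evaluates_cong) auto
    show "evaluates X K e (\<lambda>a. list_data (map bit (?D a 0)))"
      using evaluates_Atom by simp
  qed (use ns in simp_all)
  then show ?thesis by simp
qed

text \<open>The power is the place value of the current digit during the loop, and afterwards the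
  leading place value needed for the final lookup; so it is returned together with the
  table.\<close>

lemma evaluates_remaining:
  assumes r: "evaluates X K e (\<lambda>a. num (r a))" "poly_bounded X K r"
    and hs: "evaluates X K e (\<lambda>a. list_data (map inhabitant_data (hs a)))"
    and len: "poly_bounded X K (\<lambda>a. length (hs a))"
    and m: "poly_bounded X K m" "\<And>a h. a \<in> X \<Longrightarrow> h \<in> set (hs a) \<Longrightarrow> length (snd h) \<le> m a"
      "\<And>a h n. a \<in> X \<Longrightarrow> h \<in> set (hs a) \<Longrightarrow> n \<in> set (snd h) \<Longrightarrow> n \<le> m a"
    and xs: "evaluates X K e (\<lambda>a. list_data (map bit (xs a)))" "poly_bounded X K (\<lambda>a. length (xs a))"
    and bl: "poly_bounded X K (\<lambda>a. Suc (r a) ^ length (hs a))"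
  shows "evaluates X K e (\<lambda>a. Pair (num (Suc (r a) ^ length (hs a)))
    (list_data (map bit (remaining (r a) (xs a) (hs a) (length (hs a))))))"
proof -
  let ?V = "\<lambda>a. remaining (r a) (xs a) (hs a)"
  let ?acc = "\<lambda>a i. Pair (num (Suc (r a) ^ i)) (list_data (map bit (?V a i)))"
  have "evaluates X K e (\<lambda>a. ?acc a (length (map inhabitant_data (hs a))))"
  proof (rule evaluates_fold[where acc = ?acc])
    let ?Y = "SIGMA a:X. {..<length (map inhabitant_data (hs a))}"
    let ?e = "\<lambda>q. Pair (map inhabitant_data (hs (fst q)) ! snd q)
      (Pair (?acc (fst q) (snd q)) (e (fst q)))"
    let ?K = "\<lambda>q. K (fst q)"
    let ?ns = "\<lambda>q. snd (hs (fst q) ! snd q)"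
    have p: "evaluates ?Y ?K ?e (\<lambda>q. num (Suc (r (fst q)) ^ snd q))"
      by (rule evaluates_cong[OF evaluates_fst[OF evaluates_acc]]) (simp, simp)
    have pb: "poly_bounded ?Y ?K (\<lambda>q. Suc (r (fst q)) ^ snd q)"
      using poly_bounded_fst[OF bl] by (rule poly_bounded_mono) (auto intro!: power_increasing)
    have V: "evaluates ?Y ?K ?e (\<lambda>q. list_data (map bit (?V (fst q) (snd q))))"
      by (rule evaluates_cong[OF evaluates_snd[OF evaluates_acc]]) (simp, simp)
    have Vb: "poly_bounded ?Y ?K (\<lambda>q. length (?V (fst q) (snd q)))"
      using poly_bounded_fst[OF xs(2)] by (rule poly_bounded_mono) (rule length_remaining)
    have ns: "evaluates ?Y ?K ?e (\<lambda>q. list_data (map num (?ns q)))"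
      by (rule evaluates_cong[OF evaluates_snd[OF evaluates_head]]) (auto simp: inhabitant_data_def)
    have nsb: "poly_bounded ?Y ?K (\<lambda>q. length (?ns q))"
      using poly_bounded_fst[OF m(1)] by (rule poly_bounded_mono) (auto intro: m(2))
    have r': "evaluates ?Y ?K ?e (\<lambda>q. num (r (fst q)))" "poly_bounded ?Y ?K (\<lambda>q. r (fst q))"
      by (rule evaluates_outer[OF r(1)], rule poly_bounded_fst[OF r(2)])
    have rb: "poly_bounded ?Y ?K (\<lambda>q. Suc (r (fst q)))"
      using poly_bounded_add[OF r'(2) poly_bounded_const[of _ _ 1]] by simp
    have "evaluates ?Y ?K ?e (\<lambda>q. list_data (map bit
        (descend (r (fst q)) (Suc (r (fst q)) ^ snd q) (?ns q) (?V (fst q) (snd q)) (length (?ns q)))))"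
      by (rule evaluates_descend[OF r' p pb ns nsb poly_bounded_fst[OF m(1)] _ V Vb])
        (auto intro: m(3)[OF _ nth_mem])
    from evaluates_Pair[OF evaluates_times[OF evaluates_Suc[OF r'(1)] rb p pb] this]
    show "evaluates ?Y ?K ?e (\<lambda>q. ?acc (fst q) (Suc (snd q)))"
      by simp
    show "evaluates X K e (\<lambda>a. ?acc a 0)"
      using evaluates_Pair[OF evaluates_True xs(1)] by (simp add: bit_def)
  qed (use hs len in simp_all)
  then show ?thesis by simp
qed

lemma evaluates_housing_test:
  assumes r: "evaluates X K e (\<lambda>a. num (r a))" "poly_bounded X K r"
    and rows: "evaluates X K e (\<lambda>a. list_data (map (\<lambda>row. list_data (map bit row)) (rows a)))"
      "poly_bounded X K (\<lambda>a. length (rows a))"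
    and hs: "evaluates X K e (\<lambda>a. list_data (map inhabitant_data (hs a)))"
    and len: "poly_bounded X K (\<lambda>a. length (hs a))"
    and m: "poly_bounded X K m" "\<And>a h. a \<in> X \<Longrightarrow> h \<in> set (hs a) \<Longrightarrow> fst h \<le> m a"
      "\<And>a h. a \<in> X \<Longrightarrow> h \<in> set (hs a) \<Longrightarrow> length (snd h) \<le> m a"
      "\<And>a h n. a \<in> X \<Longrightarrow> h \<in> set (hs a) \<Longrightarrow> n \<in> set (snd h) \<Longrightarrow> n \<le> m a"
    and bl: "poly_bounded X K (\<lambda>a. Suc (r a) ^ length (hs a))"
  shows "evaluates X K e (\<lambda>a. bit (housing_test (r a) (rows a) (hs a)))"
proof -
  have rb: "poly_bounded X K (\<lambda>a. Suc (r a))"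
    using poly_bounded_add[OF r(2) poly_bounded_const[of _ _ 1]] by simp
  have T: "evaluates X K e (\<lambda>a. list_data (map bit (reach (Suc (r a)) (rows a) (hs a) (length (rows a)))))"
    by (rule evaluates_reach[OF rows hs len m(1,2) evaluates_Suc[OF r(1)] rb _ bl]) auto
  have Tb: "poly_bounded X K (\<lambda>a. length (reach (Suc (r a)) (rows a) (hs a) (length (rows a))))"
  proof (rule poly_bounded_mono)
    show "poly_bounded X K (\<lambda>a. 1 + length (rows a) * ((length (hs a) + 1) * Suc (r a) ^ length (hs a)))"
      by (intro poly_bounded_add poly_bounded_mult poly_bounded_const len bl rows(2))
  qed (intro length_reach, simp)
  have V: "evaluates X K e (\<lambda>a. Pair (num (Suc (r a) ^ length (hs a)))
    (list_data (map bit (remaining (r a) (reach (Suc (r a)) (rows a) (hs a) (length (rows a)))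
      (hs a) (length (hs a))))))"
    by (rule evaluates_remaining[OF r hs len m(1,3,4) T Tb bl])
  have "evaluates X K e (\<lambda>a. num (Suc (r a) ^ length (hs a)))"
    using evaluates_fst[OF V] by simp
  moreover have "evaluates X K e (\<lambda>a. list_data (map bit (remaining (r a)
      (reach (Suc (r a)) (rows a) (hs a) (length (rows a))) (hs a) (length (hs a)))))"
    using evaluates_snd[OF V] by simp
  ultimately show ?thesis
    unfolding housing_test_def
    by (intro evaluates_bit_at evaluates_times poly_bounded_mult r bl)
qed

section \<open>Correctness\<close>

text \<open>The invariant of subset sum: a set of admissible rows up to i either avoids row i, or
  adds it to a set of earlier rows, which corresponds to the shifted table.\<close>

lemma bit_at_reach:
  "bit_at (reach b rows hs i) s \<longleftrightarrow> (\<exists>S \<subseteq> {u. u < i \<and> (\<forall>h\<in>set hs. fst h \<noteq> u)}.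
    s = (\<Sum>u\<in>S. weight b (rows ! u) hs + b ^ length hs))"
proof (induction i arbitrary: s)
  case 0
  then show ?case by auto
next
  case (Suc i)
  define F where "F i = {u. u < i \<and> (\<forall>h\<in>set hs. fst h \<noteq> u)}" for i
  define f where "f u = weight b (rows ! u) hs + b ^ length hs" for u
  have IH: "bit_at (reach b rows hs i) s \<longleftrightarrow> (\<exists>S \<subseteq> F i. s = sum f S)" for s
    unfolding F_def f_def by (rule Suc.IH)
  have "bit_at (reach b rows hs (Suc i)) s \<longleftrightarrow> (\<exists>S \<subseteq> F (Suc i). s = sum f S)"
  proof (cases "\<exists>h\<in>set hs. fst h = i")
    case True
    then have "F (Suc i) = F i" by (auto simp: F_def less_Suc_eq)
    with True IH show ?thesis by simp
  next
    case False
    then have F: "F (Suc i) = insert i (F i)" by (auto simp: F_def less_Suc_eq)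
    have fin: "finite S" "i \<notin> S" if "S \<subseteq> F i" for S
      using that by (auto simp: F_def intro: finite_subset)
    have "bit_at (reach b rows hs (Suc i)) s \<longleftrightarrow>
        (\<exists>S \<subseteq> F i. s = sum f S) \<or> (\<exists>S \<subseteq> F i. s = f i + sum f S)"
      using False by (auto simp: IH f_def)
    also have "\<dots> \<longleftrightarrow> (\<exists>S \<subseteq> F (Suc i). s = sum f S)"
    proof
      assume "(\<exists>S \<subseteq> F i. s = sum f S) \<or> (\<exists>S \<subseteq> F i. s = f i + sum f S)"
      then show "\<exists>S \<subseteq> F (Suc i). s = sum f S"
      proof
        assume "\<exists>S \<subseteq> F i. s = sum f S"
        then show ?thesis unfolding F by blast
      next
        assume "\<exists>S \<subseteq> F i. s = f i + sum f S"
        then obtain S where S: "S \<subseteq> F i" "s = f i + sum f S" by blast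
        then have "s = sum f (insert i S)" using fin[OF S(1)] by simp
        with S(1) show ?thesis unfolding F by blast
      qed
    next
      assume "\<exists>S \<subseteq> F (Suc i). s = sum f S"
      then obtain S where S: "S \<subseteq> insert i (F i)" "s = sum f S" unfolding F by blast
      show "(\<exists>S \<subseteq> F i. s = sum f S) \<or> (\<exists>S \<subseteq> F i. s = f i + sum f S)"
      proof (cases "i \<in> S")
        case True
        have sub: "S - {i} \<subseteq> F i" using S(1) by blast
        have "s = f i + sum f (S - {i})"
          using sum.insert[OF fin[OF sub], of f] S(2) True by (simp add: insert_absorb)
        with sub show ?thesis by blast
      next
        case False
        with S show ?thesis by blast
      qed
    qed
    finally show ?thesis .
  qed
  then show ?case by (simp only: F_def f_def[abs_def])
qed

lemma bit_at_descend:
  "bit_at (descend r p ns xs l) s \<longleftrightarrow> (\<exists>j<l. ns ! j \<le> r \<and> bit_at xs (ns ! j * p + s))"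
  by (induction l) (auto simp: less_Suc_eq)

text \<open>Each round subtracts one digit, so a bit at s is set if some tuple c of approved digits
  leads from s back up to a set bit of \<open>xs\<close>. Nothing is asked of c from j on, so the
  induction can redefine it at j.\<close>

lemma bit_at_remaining:
  "bit_at (remaining r xs hs j) s \<longleftrightarrow> (\<exists>c. (\<forall>i<j. c i \<in> set (snd (hs ! i)) \<and> c i \<le> r) \<and>
    bit_at xs (s + (\<Sum>i<j. c i * Suc r ^ i)))"
proof (induction j arbitrary: s)
  case 0
  then show ?case by simp
next
  case (Suc j)
  have "bit_at (remaining r xs hs (Suc j)) s \<longleftrightarrow>
      (\<exists>n\<in>set (snd (hs ! j)). n \<le> r \<and> bit_at (remaining r xs hs j) (n * Suc r ^ j + s))"
    by (simp add: bit_at_descend) (metis in_set_conv_nth)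
  also have "\<dots> \<longleftrightarrow> (\<exists>c. (\<forall>i<Suc j. c i \<in> set (snd (hs ! i)) \<and> c i \<le> r) \<and>
      bit_at xs (s + (\<Sum>i<Suc j. c i * Suc r ^ i)))"
  proof
    assume "\<exists>n\<in>set (snd (hs ! j)). n \<le> r \<and> bit_at (remaining r xs hs j) (n * Suc r ^ j + s)"
    then obtain n c where n: "n \<in> set (snd (hs ! j))" "n \<le> r"
      and c: "\<forall>i<j. c i \<in> set (snd (hs ! i)) \<and> c i \<le> r"
        "bit_at xs (n * Suc r ^ j + s + (\<Sum>i<j. c i * Suc r ^ i))"
      unfolding Suc.IH by blast
    have "(\<Sum>i<j. (c(j := n)) i * Suc r ^ i) = (\<Sum>i<j. c i * Suc r ^ i)"
      by (rule sum.cong) auto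
    then have "n * Suc r ^ j + s + (\<Sum>i<j. c i * Suc r ^ i) =
        s + (\<Sum>i<Suc j. (c(j := n)) i * Suc r ^ i)"
      by simp
    with n c show "\<exists>c. (\<forall>i<Suc j. c i \<in> set (snd (hs ! i)) \<and> c i \<le> r) \<and>
        bit_at xs (s + (\<Sum>i<Suc j. c i * Suc r ^ i))"
      by (intro exI[of _ "c(j := n)"]) (auto simp: less_Suc_eq)
  next
    assume "\<exists>c. (\<forall>i<Suc j. c i \<in> set (snd (hs ! i)) \<and> c i \<le> r) \<and>
        bit_at xs (s + (\<Sum>i<Suc j. c i * Suc r ^ i))"
    then obtain c where c: "\<forall>i<Suc j. c i \<in> set (snd (hs ! i)) \<and> c i \<le> r"
        "bit_at xs (s + (\<Sum>i<Suc j. c i * Suc r ^ i))"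
      by blast
    have "s + (\<Sum>i<Suc j. c i * Suc r ^ i) = c j * Suc r ^ j + s + (\<Sum>i<j. c i * Suc r ^ i)"
      by simp
    with c have "bit_at (remaining r xs hs j) (c j * Suc r ^ j + s)"
      unfolding Suc.IH by (intro exI[of _ c]) (simp del: sum.lessThan_Suc)
    with c(1) show "\<exists>n\<in>set (snd (hs ! j)). n \<le> r \<and> bit_at (remaining r xs hs j) (n * Suc r ^ j + s)"
      by blast
  qed
  finally show ?case .
qed

section \<open>Expansions in base \<open>r + 1\<close>\<close>

lemma digits_less:
  fixes c :: "nat \<Rightarrow> nat"
  assumes "\<And>j. j < m \<Longrightarrow> c j \<le> r"
  shows "(\<Sum>j<m. c j * Suc r ^ j) < Suc r ^ m"
  using assms
proof (induction m)
  case (Suc m)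
  then have "(\<Sum>j<m. c j * Suc r ^ j) < Suc r ^ m" by simp
  moreover have "c m * Suc r ^ m \<le> r * Suc r ^ m" using Suc.prems by (intro mult_right_mono) auto
  ultimately have "(\<Sum>j<m. c j * Suc r ^ j) + c m * Suc r ^ m < Suc r ^ m + r * Suc r ^ m"
    by (rule add_less_le_mono)
  then show ?case by simp
qed simp

lemma add_mult_eq_cancel:
  fixes x y q q' b :: nat
  assumes "x + q * b = y + q' * b" "x < b" "y < b"
  shows "q = q' \<and> x = y"
proof -
  have "(x + q * b) div b = (y + q' * b) div b" "(x + q * b) mod b = (y + q' * b) mod b"
    using assms(1) by simp_all
  with assms(2,3) show ?thesis by simp
qed

text \<open>The lower part is below \<open>Suc r ^ m\<close>, so division with remainder isolates
  the leading digit; induction treats the others.\<close>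

lemma digits_unique:
  fixes c d :: "nat \<Rightarrow> nat"
  assumes "\<And>j. j < m \<Longrightarrow> c j \<le> r" "\<And>j. j < m \<Longrightarrow> d j \<le> r"
    and "(\<Sum>j<m. c j * Suc r ^ j) = (\<Sum>j<m. d j * Suc r ^ j)" "j < m"
  shows "c j = d j"
  using assms
proof (induction m)
  case (Suc m)
  have "c m = d m \<and> (\<Sum>j<m. c j * Suc r ^ j) = (\<Sum>j<m. d j * Suc r ^ j)"
    using Suc.prems by (intro add_mult_eq_cancel[where b = "Suc r ^ m"] digits_less) auto
  with Suc show ?case by (auto simp: less_Suc_eq)
qed simp

text \<open>Double counting: exchanging the sums over vertices and inhabitants collects, at
  \<open>b ^ j\<close>, one unit per row of S with a bit at the j-th home. These coefficients need
  not be below b yet.\<close>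

lemma sum_weight:
  assumes "finite S"
  shows "(\<Sum>u\<in>S. weight b (rows ! u) hs + b ^ length hs) =
    (\<Sum>j<length hs. card {u \<in> S. bit_at (rows ! u) (fst (hs ! j))} * b ^ j) + card S * b ^ length hs"
proof -
  have "(\<Sum>u\<in>S. weight b (rows ! u) hs) =
      (\<Sum>j<length hs. \<Sum>u\<in>S. if bit_at (rows ! u) (fst (hs ! j)) then b ^ j else 0)"
    unfolding weight_def by (rule sum.swap)
  also have "\<dots> = (\<Sum>j<length hs. card {u \<in> S. bit_at (rows ! u) (fst (hs ! j))} * b ^ j)"
    using assms by (intro sum.cong refl) (simp add: sum.If_cases Int_def)
  finally show ?thesis by (simp add: sum.distrib)
qed

text \<open>A set of more than \<open>r\<close> vertices could cause carries, but its sum exceeds all targets because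
  its size is the leading digit.\<close>

lemma housing_test_iff:
  "housing_test r rows hs \<longleftrightarrow> (\<exists>S \<subseteq> {u. u < length rows \<and> (\<forall>h\<in>set hs. fst h \<noteq> u)}. card S = r \<and>
    (\<forall>j<length hs. card {u \<in> S. bit_at (rows ! u) (fst (hs ! j))} \<in> set (snd (hs ! j))))"
proof -
  let ?m = "length hs" and ?b = "Suc r"
  let ?F = "{u. u < length rows \<and> (\<forall>h\<in>set hs. fst h \<noteq> u)}"
  define d where "d S j = card {u \<in> S. bit_at (rows ! u) (fst (hs ! j))}" for S j
  have fin: "finite S" if "S \<subseteq> ?F" for S using that by (auto intro: finite_subset)
  have d_le: "d S j \<le> card S" if "S \<subseteq> ?F" for S j
    unfolding d_def using fin[OF that] by (intro card_mono) auto
  have "housing_test r rows hs \<longleftrightarrow> (\<exists>S \<subseteq> ?F. \<exists>c. (\<forall>j<?m. c j \<in> set (snd (hs ! j)) \<and> c j \<le> r) \<and>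
      r * ?b ^ ?m + (\<Sum>j<?m. c j * ?b ^ j) = (\<Sum>u\<in>S. weight ?b (rows ! u) hs + ?b ^ ?m))"
    unfolding housing_test_def bit_at_remaining bit_at_reach by blast
  also have "\<dots> \<longleftrightarrow> (\<exists>S \<subseteq> ?F. \<exists>c. (\<forall>j<?m. c j \<in> set (snd (hs ! j)) \<and> c j \<le> r) \<and>
      (\<Sum>j<?m. c j * ?b ^ j) + r * ?b ^ ?m = (\<Sum>j<?m. d S j * ?b ^ j) + card S * ?b ^ ?m)"
    by (intro ex_cong1 conj_cong refl)
      (simp only: sum_weight[OF fin] d_def add.commute[of "r * ?b ^ ?m"])
  also have "\<dots> \<longleftrightarrow> (\<exists>S \<subseteq> ?F. card S = r \<and> (\<forall>j<?m. d S j \<in> set (snd (hs ! j))))"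
  proof (intro ex_cong1 conj_cong refl iffI)
    fix S
    assume S: "S \<subseteq> ?F"
    assume "\<exists>c. (\<forall>j<?m. c j \<in> set (snd (hs ! j)) \<and> c j \<le> r) \<and>
      (\<Sum>j<?m. c j * ?b ^ j) + r * ?b ^ ?m = (\<Sum>j<?m. d S j * ?b ^ j) + card S * ?b ^ ?m"
    then obtain c where c: "\<And>j. j < ?m \<Longrightarrow> c j \<in> set (snd (hs ! j))" "\<And>j. j < ?m \<Longrightarrow> c j \<le> r"
      and eq: "(\<Sum>j<?m. c j * ?b ^ j) + r * ?b ^ ?m = (\<Sum>j<?m. d S j * ?b ^ j) + card S * ?b ^ ?m"
      by blast
    have less: "(\<Sum>j<?m. c j * ?b ^ j) < ?b ^ ?m" by (rule digits_less[OF c(2)])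
    have le: "card S \<le> r"
    proof (rule ccontr)
      assume "\<not> card S \<le> r"
      then have "?b * ?b ^ ?m \<le> card S * ?b ^ ?m" by (intro mult_right_mono) auto
      with less eq show False by simp
    qed
    \<comment> \<open>Once \<open>card S\<close> is at most r, so is every count; both sides are
      then expansions without carries and can be compared digit by digit.\<close>
    have d: "d S j \<le> r" for j using d_le[OF S, of j] le by simp
    from add_mult_eq_cancel[OF eq less digits_less[OF d]]
    have *: "r = card S" "(\<Sum>j<?m. c j * ?b ^ j) = (\<Sum>j<?m. d S j * ?b ^ j)" by auto
    have "d S j \<in> set (snd (hs ! j))" if "j < ?m" for j
      using digits_unique[OF c(2) d *(2) that] c(1)[OF that] by simp
    with *(1) show "card S = r \<and> (\<forall>j<?m. d S j \<in> set (snd (hs ! j)))" by auto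
  next
    fix S
    assume "S \<subseteq> ?F" "card S = r \<and> (\<forall>j<?m. d S j \<in> set (snd (hs ! j)))"
    then show "\<exists>c. (\<forall>j<?m. c j \<in> set (snd (hs ! j)) \<and> c j \<le> r) \<and>
      (\<Sum>j<?m. c j * ?b ^ j) + r * ?b ^ ?m = (\<Sum>j<?m. d S j * ?b ^ j) + card S * ?b ^ ?m"
      using d_le by (intro exI[of _ "d S"]) auto
  qed
  finally show ?thesis unfolding d_def .
qed

section \<open>From instances to lists\<close>

lemma position_less: "x \<in> set xs \<Longrightarrow> position xs x < length xs"
  unfolding position_def by (induction xs) auto

lemma nth_position: "x \<in> set xs \<Longrightarrow> xs ! position xs x = x"
  unfolding position_def by (induction xs) auto

text \<open>Refugees are anonymous: approval sees a housing only through its image, and a set of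
  free vertices of the right size is the image of some bijection.\<close>

lemma arh_yes_iff:
  assumes "arh_instance J"
  shows "arh_yes J \<longleftrightarrow> (\<exists>W \<subseteq> unoccupied J. card W = card (refugees J) \<and>
    (\<forall>h\<in>inhabitants J. card (nbhd J (home J h) \<inter> W) \<in> approval J h))"
proof
  assume "arh_yes J"
  then show "\<exists>W \<subseteq> unoccupied J. card W = card (refugees J) \<and>
    (\<forall>h\<in>inhabitants J. card (nbhd J (home J h) \<inter> W) \<in> approval J h)"
    unfolding arh_yes_def housing_def inhabitant_respecting_def by (metis card_image)
next
  assume "\<exists>W \<subseteq> unoccupied J. card W = card (refugees J) \<and>
    (\<forall>h\<in>inhabitants J. card (nbhd J (home J h) \<inter> W) \<in> approval J h)"
  then obtain W where W: "W \<subseteq> unoccupied J" "card W = card (refugees J)"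
    "\<forall>h\<in>inhabitants J. card (nbhd J (home J h) \<inter> W) \<in> approval J h" by blast
  have "finite (verts J)" "finite (refugees J)"
    using assms unfolding arh_instance_def simple_graph_def by auto
  moreover from this have "finite W" using W(1) unfolding unoccupied_def by (auto intro: finite_subset)
  ultimately obtain \<pi> where "bij_betw \<pi> (refugees J) W"
    using W(2) finite_same_card_bij by metis
  then have "\<pi> ` refugees J = W" "inj_on \<pi> (refugees J)" unfolding bij_betw_def by auto
  with W show "arh_yes J"
    unfolding arh_yes_def housing_def inhabitant_respecting_def by metis
qed

text \<open>As \<open>vs\<close> is distinct, indexing into it identifies sets of positions with
  sets of vertices and preserves cardinalities.\<close>

lemma housing_test_correct:
  assumes J: "arh_instance J"
    and vs: "distinct vs" "set vs = verts J" and hs: "set hs = inhabitants J"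
  shows "housing_test (card (refugees J)) (map (\<lambda>u. map (\<lambda>v. {u, v} \<in> edges J) vs) vs)
      (map (\<lambda>h. (position vs (home J h), sorted_list_of_set (approval J h))) hs) \<longleftrightarrow> arh_yes J"
    (is "housing_test ?r ?rows ?hs \<longleftrightarrow> _")
proof -
  let ?F = "{u. u < length ?rows \<and> (\<forall>h\<in>set ?hs. fst h \<noteq> u)}"
  have home: "home J h \<in> set vs" if "h \<in> inhabitants J" for h
    using J that vs(2) unfolding arh_instance_def by auto
  have fin: "finite (approval J h)" if "h \<in> inhabitants J" for h
    using J that unfolding arh_instance_def by (meson finite_atLeastAtMost finite_subset)
  have inj: "inj_on ((!) vs) {..<length vs}"
    using vs(1) by (auto simp: inj_on_def nth_eq_iff_index_eq)
  have F: "(!) vs ` ?F = unoccupied J"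
  proof (intro equalityI subsetI)
    fix v
    assume "v \<in> (!) vs ` ?F"
    then obtain u where u: "u < length vs" "\<forall>h\<in>set hs. position vs (home J h) \<noteq> u" "v = vs ! u"
      by auto
    have "v \<noteq> home J h" if "h \<in> inhabitants J" for h
    proof
      assume "v = home J h"
      then have "vs ! position vs (home J h) = vs ! u" using nth_position[OF home[OF that]] u(3) by simp
      with vs(1) u position_less[OF home[OF that]] that hs show False
        by (simp add: nth_eq_iff_index_eq)
    qed
    with u vs(2) show "v \<in> unoccupied J" unfolding unoccupied_def occupied_def by auto
  next
    fix v
    assume v: "v \<in> unoccupied J"
    then obtain u where u: "u < length vs" "v = vs ! u"
      using vs(2) unfolding unoccupied_def by (metis Diff_iff in_set_conv_nth)
    have "position vs (home J h) \<noteq> u" if "h \<in> set hs" for h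
      using v u nth_position[OF home[of h]] that hs unfolding unoccupied_def occupied_def by auto
    with u show "v \<in> (!) vs ` ?F" by auto
  qed
  \<comment> \<open>The matrix is read in the row of the candidate vertex and the column of the
    home, whereas \<open>nbhd\<close> starts from the home; both name the same unordered
    edge.\<close>
  have count: "card {u \<in> S. bit_at (?rows ! u) (position vs (home J h))} =
      card (nbhd J (home J h) \<inter> (!) vs ` S)"
    if S: "S \<subseteq> ?F" and h: "h \<in> inhabitants J" for S h
  proof -
    have "bit_at (?rows ! u) (position vs (home J h)) \<longleftrightarrow> vs ! u \<in> nbhd J (home J h)" if "u \<in> S" for u
      using that S position_less[OF home[OF h]] nth_position[OF home[OF h]]
      by (auto simp: bit_at_def nbhd_def insert_commute)
    then have "nbhd J (home J h) \<inter> (!) vs ` S =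
        (!) vs ` {u \<in> S. bit_at (?rows ! u) (position vs (home J h))}"
      by auto
    moreover have "inj_on ((!) vs) {u \<in> S. bit_at (?rows ! u) (position vs (home J h))}"
      using S by (intro inj_on_subset[OF inj]) auto
    ultimately show ?thesis by (simp add: card_image)
  qed
  have "housing_test ?r ?rows ?hs \<longleftrightarrow> (\<exists>S \<subseteq> ?F. card S = ?r \<and>
      (\<forall>h\<in>set hs. card {u \<in> S. bit_at (?rows ! u) (position vs (home J h))} \<in> approval J h))"
  proof -
    have "set (sorted_list_of_set (approval J (hs ! j))) = approval J (hs ! j)" if "j < length hs" for j
      using fin hs nth_mem[OF that] by simp
    then have "(\<forall>j<length ?hs. card {u \<in> S. bit_at (?rows ! u) (fst (?hs ! j))} \<in> set (snd (?hs ! j))) \<longleftrightarrow>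
      (\<forall>h\<in>set hs. card {u \<in> S. bit_at (?rows ! u) (position vs (home J h))} \<in> approval J h)" for S
      unfolding all_set_conv_all_nth[of hs] by (simp del: set_sorted_list_of_set)
    then show ?thesis unfolding housing_test_iff by (simp only:)
  qed
  also have "\<dots> \<longleftrightarrow> (\<exists>S \<subseteq> ?F. card ((!) vs ` S) = ?r \<and>
      (\<forall>h\<in>inhabitants J. card (nbhd J (home J h) \<inter> (!) vs ` S) \<in> approval J h))"
  proof (intro ex_cong1 conj_cong refl)
    fix S
    assume S: "S \<subseteq> ?F"
    then have "inj_on ((!) vs) S" by (intro inj_on_subset[OF inj]) auto
    then show "card S = ?r \<longleftrightarrow> card ((!) vs ` S) = ?r" by (simp add: card_image)
    show "(\<forall>h\<in>set hs. card {u \<in> S. bit_at (?rows ! u) (position vs (home J h))} \<in> approval J h) \<longleftrightarrow>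
        (\<forall>h\<in>inhabitants J. card (nbhd J (home J h) \<inter> (!) vs ` S) \<in> approval J h)"
      using count[OF S] hs by simp
  qed
  also have "\<dots> \<longleftrightarrow> arh_yes J"
    unfolding arh_yes_iff[OF J] F[symmetric] subset_image_iff by blast
  finally show ?thesis .
qed

section \<open>Running time\<close>

lemma computable_if_evaluates:
  assumes "evaluates UNIV K num (\<lambda>k. num (f k))"
  shows "computable f"
  using assms
proof (rule evaluatesE)
  fix p N T
  assume p: "\<And>k s. k \<in> UNIV \<Longrightarrow> s 0 = num k \<Longrightarrow>
    \<exists>t s'. exec p s t s' \<and> t \<le> T k \<and> s' 0 = num (f k) \<and> (\<forall>x \<ge> N. s' x = s x)"
  have "\<exists>t. outputs p (num k) t (num (f k))" for k
    using p[of k "(\<lambda>_. Atom)(0 := num k)"] unfolding outputs_def by auto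
  then show ?thesis unfolding computable_def by blast
qed

lemma computable_bound: "computable (\<lambda>k. ((k + 2) ^ (k + 2) + 2) ^ c)"
proof (rule computable_if_evaluates)
  let ?F = "\<lambda>k. (k + 2) ^ (k + 2) :: nat"
  \<comment> \<open>Computability sets no time limit, so K is simply chosen to dominate k and both
    powers, which makes the required bounds immediate.\<close>
  let ?K = "\<lambda>k. k + ?F k + (?F k + 2) ^ c"
  have k: "evaluates UNIV ?K num num" "poly_bounded UNIV ?K (\<lambda>k. k)"
    by (rule evaluates_env, rule poly_bounded_mono[OF poly_bounded_self], simp)
  have F: "poly_bounded UNIV ?K ?F" "poly_bounded UNIV ?K (\<lambda>k. (?F k + 2) ^ c)"
    by (rule poly_bounded_mono[OF poly_bounded_self], simp)+
  have add2: "evaluates UNIV ?K num (\<lambda>k. num (g k + 2))"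
    if "evaluates UNIV ?K num (\<lambda>k. num (g k))" for g
    using evaluates_Suc[OF evaluates_Suc[OF that]] by simp
  have const: "evaluates UNIV ?K num (\<lambda>k. num n)" for n
    by (induction n) (simp_all only: evaluates_Suc num.simps(1) evaluates_Atom)
  have k2: "evaluates UNIV ?K num (\<lambda>k. num (k + 2))" "poly_bounded UNIV ?K (\<lambda>k. k + 2)"
    by (rule add2[OF k(1)], intro poly_bounded_add poly_bounded_const k(2))
  have "evaluates UNIV ?K num (\<lambda>k. num (?F k))"
    by (rule evaluates_power[OF k2 _ k2 F(1)]) simp
  from evaluates_power[OF add2[OF this] poly_bounded_add[OF F(1) poly_bounded_const] _
      const poly_bounded_const F(2)]
  show "evaluates UNIV ?K num (\<lambda>k. num ((?F k + 2) ^ c))" by simp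
qed

lemma less_nodes_num: "n < nodes (num n)"
  by (induction n) auto

lemma length_less_nodes: "length xs < nodes (list_data xs)"
  by (induction xs) auto

lemma nodes_less_list_data: "x \<in> set xs \<Longrightarrow> nodes x < nodes (list_data xs)"
  by (induction xs) auto

text \<open>Unary coding keeps every number and every list length below the size of the tree
  containing it.\<close>

lemma inhabitant_data_bounds:
  assumes "h \<in> set hs" "nodes (list_data (map inhabitant_data hs)) \<le> m"
  shows "fst h \<le> m" "length (snd h) \<le> m" "n \<in> set (snd h) \<Longrightarrow> n \<le> m"
proof -
  have h: "nodes (inhabitant_data h) < m"
    using nodes_less_list_data[of "inhabitant_data h" "map inhabitant_data hs"] assms by simp
  show "fst h \<le> m"
    using h less_nodes_num[of "fst h"] by (simp add: inhabitant_data_def)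
  show "length (snd h) \<le> m"
    using h length_less_nodes[of "map num (snd h)"] by (simp add: inhabitant_data_def)
  show "n \<le> m" if "n \<in> set (snd h)"
    using h less_nodes_num[of n] nodes_less_list_data[of "num n" "map num (snd h)"] that
    by (simp add: inhabitant_data_def)
qed

theorem theorem3p16:
  shows "fixed_parameter_tractable
           {J :: (nat, nat, nat) arh. arh_instance J}
           arh_yes
           (\<lambda>J. card (refugees J) + card (inhabitants J))
           arh_represented_by"
proof -
  \<comment> \<open>Since r + 1 and m are at most k + 2, this dominates (r + 1)^m.\<close>
  define F where "F k = (k + 2) ^ (k + 2)" for k :: nat
  let ?par = "\<lambda>J :: (nat, nat, nat) arh. card (refugees J) + card (inhabitants J)"
  \<comment> \<open>An instance has a code for each choice of enumerations; indexing by triples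
    makes the code a function of the index while one program serves all codes.\<close>
  define X where "X = {(J :: (nat, nat, nat) arh, vs, hs). arh_instance J \<and>
    distinct vs \<and> set vs = verts J \<and> distinct hs \<and> set hs = inhabitants J}"
  define e where "e = (\<lambda>(J :: (nat, nat, nat) arh, vs, hs). arh_code J vs hs)"
  \<comment> \<open>A product of positive factors dominates each of them, the input size as well as
    the exponential term, and can be separated again at the end.\<close>
  define K where "K = (\<lambda>a. F (?par (fst a)) * nodes (e a))"
  define r where "r = (\<lambda>(J :: (nat, nat, nat) arh, vs :: nat list, hs :: nat list). card (refugees J))"
  define rows where "rows = (\<lambda>(J :: (nat, nat, nat) arh, vs, hs :: nat list).
    map (\<lambda>u. map (\<lambda>v. {u, v} \<in> edges J) vs) vs)"
  define inhs where "inhs = (\<lambda>(J :: (nat, nat, nat) arh, vs, hs).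
    map (\<lambda>h. (position vs (home J h), sorted_list_of_set (approval J h))) hs)"
  have e: "e a = list_data [num (r a), list_data (map (\<lambda>row. list_data (map bit row)) (rows a)),
      list_data (map inhabitant_data (inhs a))]" for a
    by (cases a) (simp add: e_def r_def rows_def inhs_def arh_code_def inhabitant_data_def comp_def)
  have F_pos: "F k > 0" for k by (simp add: F_def)
  have nodes_le_K: "nodes (e a) \<le> K a" for a
    unfolding K_def using mult_le_mono1[OF Suc_leI[OF F_pos], of "nodes (e a)"] by simp
  have F_le_K: "F (?par (fst a)) \<le> K a" for a unfolding K_def e by simp
  have self: "poly_bounded X K f" if "\<And>a. a \<in> X \<Longrightarrow> f a \<le> K a" for f
    using poly_bounded_self that by (rule poly_bounded_mono)
  have "evaluates X K e (\<lambda>a. bit (housing_test (r a) (rows a) (inhs a)))"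
  proof (rule evaluates_housing_test[where m = "\<lambda>a. nodes (e a)"])
    show "evaluates X K e (\<lambda>a. num (r a))"
      by (rule evaluates_cong[OF evaluates_fst[OF evaluates_env]]) (simp, simp add: e)
    show "evaluates X K e (\<lambda>a. list_data (map (\<lambda>row. list_data (map bit row)) (rows a)))"
      by (rule evaluates_cong[OF evaluates_fst[OF evaluates_snd[OF evaluates_env]]]) (simp, simp add: e)
    show "evaluates X K e (\<lambda>a. list_data (map inhabitant_data (inhs a)))"
      by (rule evaluates_cong[OF evaluates_fst[OF evaluates_snd[OF evaluates_snd[OF evaluates_env]]]])
        (simp, simp add: e)
    show "poly_bounded X K r"
    proof (rule self)
      fix a
      have "r a \<le> nodes (e a)" using less_nodes_num[of "r a"] by (simp add: e)
      with nodes_le_K show "r a \<le> K a" by (rule order_trans[rotated])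
    qed
    show "poly_bounded X K (\<lambda>a. length (rows a))"
    proof (rule self)
      fix a
      have "length (rows a) \<le> nodes (e a)"
        using length_less_nodes[of "map (\<lambda>row. list_data (map bit row)) (rows a)"] by (simp add: e)
      with nodes_le_K show "length (rows a) \<le> K a" by (rule order_trans[rotated])
    qed
    show "poly_bounded X K (\<lambda>a. length (inhs a))"
    proof (rule self)
      fix a
      have "length (inhs a) \<le> nodes (e a)"
        using length_less_nodes[of "map inhabitant_data (inhs a)"] by (simp add: e)
      with nodes_le_K show "length (inhs a) \<le> K a" by (rule order_trans[rotated])
    qed
    show "poly_bounded X K (\<lambda>a. nodes (e a))"
      by (rule self[OF nodes_le_K])
    show "poly_bounded X K (\<lambda>a. Suc (r a) ^ length (inhs a))"
    proof (rule self)
      fix a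
      assume "a \<in> X"
      then have "length (inhs a) = card (inhabitants (fst a))" "r a = card (refugees (fst a))"
        by (auto simp: X_def inhs_def r_def dest: distinct_card)
      then have "Suc (r a) \<le> ?par (fst a) + 2" "length (inhs a) \<le> ?par (fst a) + 2" by simp_all
      then have "Suc (r a) ^ length (inhs a) \<le> (?par (fst a) + 2) ^ length (inhs a)"
        "(?par (fst a) + 2) ^ length (inhs a) \<le> F (?par (fst a))"
        unfolding F_def by (intro power_mono power_increasing; simp)+
      with F_le_K[of a] show "Suc (r a) ^ length (inhs a) \<le> K a" by linarith
    qed
    fix a h n
    assume h: "h \<in> set (inhs a)"
    have "nodes (list_data (map inhabitant_data (inhs a))) \<le> nodes (e a)" by (simp add: e)
    note * = inhabitant_data_bounds[OF h this]
    show "fst h \<le> nodes (e a)" "length (snd h) \<le> nodes (e a)" by (fact *)+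
    show "n \<in> set (snd h) \<Longrightarrow> n \<le> nodes (e a)" by (fact *)
  qed
  then obtain p N T where T: "poly_bounded X K T" and p: "\<And>a s. a \<in> X \<Longrightarrow> s 0 = e a \<Longrightarrow>
      \<exists>t s'. exec p s t s' \<and> t \<le> T a \<and> s' 0 = bit (housing_test (r a) (rows a) (inhs a)) \<and>
        (\<forall>x \<ge> N. s' x = s x)"
    by (elim evaluatesE) blast
  from T obtain c where c: "\<And>a. a \<in> X \<Longrightarrow> T a \<le> (K a + 2) ^ c"
    unfolding poly_bounded_def by blast
  have "\<exists>t q. outputs p d t q \<and> t \<le> (F (?par J) + 2) ^ c * nodes d ^ c \<and> (q \<noteq> Atom \<longleftrightarrow> arh_yes J)"
    if J: "arh_instance J" and d: "arh_represented_by J d" for J :: "(nat, nat, nat) arh" and d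
  proof -
    obtain vs hs where vs: "distinct vs" "set vs = verts J" and hs: "distinct hs" "set hs = inhabitants J"
      and code: "d = arh_code J vs hs"
      using d unfolding arh_represented_by_def by blast
    let ?a = "(J, vs, hs)"
    have a: "?a \<in> X" "e ?a = d" using J vs hs code by (auto simp: X_def e_def)
    obtain t s' where run: "exec p ((\<lambda>_. Atom)(0 := d)) t s'" "t \<le> T ?a"
      "s' 0 = bit (housing_test (r ?a) (rows ?a) (inhs ?a))"
      using p[OF a(1), of "(\<lambda>_. Atom)(0 := d)"] a(2) by auto
    have "nodes d > 0" by (cases d) auto
    \<comment> \<open>As the input size is at least 1, the summand 2 can be absorbed into the
      parameter factor; only in this form does the c-th power split as required.\<close>
    then have "K ?a + 2 \<le> (F (?par J) + 2) * nodes d"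
      unfolding K_def a(2) by (simp add: add_mult_distrib)
    then have "(K ?a + 2) ^ c \<le> (F (?par J) + 2) ^ c * nodes d ^ c"
      by (metis power_mono power_mult_distrib zero_le)
    then have "t \<le> (F (?par J) + 2) ^ c * nodes d ^ c"
      using run(2) c[OF a(1)] by linarith
    moreover have "s' 0 \<noteq> Atom \<longleftrightarrow> arh_yes J"
      using run(3) housing_test_correct[OF J vs hs(2)] by (simp add: r_def rows_def inhs_def)
    ultimately show ?thesis using run(1) unfolding outputs_def by blast
  qed
  then show ?thesis
    unfolding fixed_parameter_tractable_def using computable_bound[of c, folded F_def] by blast
qed

end
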